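(* In the logistic setting, with $(\hat\theta_t,P_t)$ produced by the truncated Extended Kalman Filter with parameter $0<\beta<1/2$, assume: (i) $(X_t,y_t)_{t\ge1}$ are i.i.d. copies of $(X,y)\in\mathcal X\times\{-1,1\}$, $\mathbb E[XX^T]$ is positive definite and $\|x\|\le D_X$ for all $x\in\mathcal X$; (ii) there is $\theta^*\in\mathbb R^d$ with $L(\theta^* )=\inf_{\theta\in\mathbb R^d}L(\theta)$; (iii) for any $\delta,\varepsilon>0$ there exists $\tau(\varepsilon,\delta)\in\mathbb N$ such that, with probability at least $1-\delta$, simultaneously for all $t>\tau(\varepsilon,\delta)$, $$\|\hat\theta_t-\theta^*\|\le\varepsilon\quad\text{and}\quad\alpha_t=\frac1{(1+e^{\hat\theta_t^TX_t})(1+e^{-\hat\theta_t^TX_t})}.$$ Then for any $\delta>0$, with probability at least $1-4\delta$, it holds simultaneously for all $n\ge1$ that $$\begin{aligned}\sum_{t=1}^n\big(L(\hat\theta_t)-L(\theta^* )\big)\le{}&3d\,e^{D_X\|\theta^*\|}\ln\!\left(1+n\frac{\lambda_{\max}(P_1)D_X^2}{4d}\right)+\frac{\lambda_{\max}(P_1^{-1})}{75D_X^2}+64e^{D_X\|\theta^*\|}\ln\delta^{-1}\\&+\tau\!\left(\tfrac1{20D_X},\delta\right)\left(\frac1{300}+D_X\|\hat\theta_1-\theta^*\|\right)+\tau\!\left(\tfrac1{20D_X},\delta\right)^2\frac{\lambda_{\max}(P_1)D_X^2}2.\end{aligned}$$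
   Context: Let $d\ge1$, $\mathcal X\subset\mathbb R^d$; $\|\cdot\|$ is the Euclidean norm and $\lambda_{\max}$ the largest eigenvalue. Logistic loss: $\ell(y,\theta^Tx)=\ln(1+e^{-y\theta^Tx})$ for $y\in\{-1,1\}$; risk $L(\theta)=\mathbb E[\ell(y,\theta^TX)]$. The data need not follow a logistic model. Truncated Extended Kalman Filter for logistic regression with parameter $0<\beta<1/2$: $P_1$ is any (deterministic) positive definite matrix, $\hat\theta_1\in\mathbb R^d$ any (deterministic) vector, and for $t=1,2,\dots$ $$\alpha_t=\max\left(\frac1{t^\beta},\frac1{(1+e^{\hat\theta_t^TX_t})(1+e^{-\hat\theta_t^TX_t})}\right),\quad P_{t+1}=P_t-\frac{P_tX_tX_t^TP_t}{1+X_t^TP_tX_t\alpha_t}\alpha_t,\quad\hat\theta_{t+1}=\hat\theta_t+P_{t+1}\frac{y_tX_t}{1+e^{y_t\hat\theta_t^TX_t}}.$$ *)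

theory Defs
  imports "HOL-Probability.Probability"
begin

definition outer :: "real ^ 'n \<Rightarrow> real ^ 'n \<Rightarrow> real ^ 'n ^ 'n" where
  "outer u v = (\<chi> i j. u $ i * v $ j)"

definition pos_def :: "real ^ 'n ^ 'n \<Rightarrow> bool" where
  "pos_def A \<longleftrightarrow> transpose A = A \<and> (\<forall>v. v \<noteq> 0 \<longrightarrow> v \<bullet> (A *v v) > 0)"

definition is_eigenvalue :: "real ^ 'n ^ 'n \<Rightarrow> real \<Rightarrow> bool" where
  "is_eigenvalue A k \<longleftrightarrow> (\<exists>v. v \<noteq> 0 \<and> A *v v = k *\<^sub>R v)"

(* Meaningful whenever A has a real eigenvalue, in particular for symmetric A. *)
definition lambda_max :: "real ^ 'n ^ 'n \<Rightarrow> real" where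
  "lambda_max A = (GREATEST k. is_eigenvalue A k)"

definition logistic_loss :: "real \<Rightarrow> real \<Rightarrow> real" where
  "logistic_loss y z = ln (1 + exp (- y * z))"

definition logistic_risk ::
  "'w measure \<Rightarrow> ('w \<Rightarrow> real ^ 'n) \<Rightarrow> ('w \<Rightarrow> real) \<Rightarrow> real ^ 'n \<Rightarrow> real" where
  "logistic_risk M X y \<theta> = (LINT \<omega>|M. logistic_loss (y \<omega>) (\<theta> \<bullet> X \<omega>))"

definition logistic_weight :: "real ^ 'n \<Rightarrow> real ^ 'n \<Rightarrow> real" where
  "logistic_weight \<theta> x = 1 / ((1 + exp (\<theta> \<bullet> x)) * (1 + exp (- (\<theta> \<bullet> x))))"

(* The recursion along one data trajectory (x t, y t).  Time starts at t = 1;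
   the values of all sequences at index 0 are irrelevant. *)
definition truncated_ekf ::
  "real \<Rightarrow> real ^ 'n ^ 'n \<Rightarrow> real ^ 'n \<Rightarrow> (nat \<Rightarrow> real ^ 'n) \<Rightarrow> (nat \<Rightarrow> real)
    \<Rightarrow> (nat \<Rightarrow> real) \<Rightarrow> (nat \<Rightarrow> real ^ 'n ^ 'n) \<Rightarrow> (nat \<Rightarrow> real ^ 'n) \<Rightarrow> bool" where
  "truncated_ekf \<beta> P1 \<theta>1 x y \<alpha> P \<theta> \<longleftrightarrow>
     P 1 = P1 \<and> \<theta> 1 = \<theta>1 \<and>
     (\<forall>t\<ge>1.
        \<alpha> t = max (1 / real t powr \<beta>) (logistic_weight (\<theta> t) (x t)) \<and>
        P (Suc t) = P t - (\<alpha> t / (1 + (x t \<bullet> (P t *v x t)) * \<alpha> t))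
                            *\<^sub>R (P t ** outer (x t) (x t) ** P t) \<and>
        \<theta> (Suc t) = \<theta> t + P (Suc t) *v ((y t / (1 + exp (y t * (\<theta> t \<bullet> x t)))) *\<^sub>R x t))"

end

theory Submission
  imports Defs
begin

text \<open>
  Write \<open>u\<^sub>t\<close> for \<open>(\<theta>\<^sub>t - \<theta>star) \<bullet> X\<^sub>t\<close>, \<open>g\<^sub>t\<close> for the derivative of the loss at time \<open>t\<close> times
  \<open>u\<^sub>t\<close>, and \<open>w\<^sub>t\<close> for the logistic weight. As \<open>P\<^sub>t\<close> is the inverse of the information matrix
  \<open>P\<^sub>1\<^sup>-\<^sup>1 + \<Sum> \<alpha>\<^sub>s X\<^sub>s X\<^sub>s\<^sup>T\<close>, following the error in the information norm bounds the sum of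
  \<open>2 g\<^sub>t - w\<^sub>t u\<^sub>t\<^sup>2\<close> after time \<open>\<tau>\<close> by the error at time \<open>\<tau> + 1\<close> plus a term controlled by the growth of
  the log-determinant of the information matrix. In the neighbourhood of \<open>\<theta>star\<close> reached after \<open>\<tau>\<close>, the
  excess risk is smaller than the conditional mean of \<open>2 g\<^sub>t - w\<^sub>t u\<^sub>t\<^sup>2\<close> by a multiple of the curvature,
  and that multiple pays for the conditional variance. Hence the exponential of a small multiple of
  \<open>L \<theta>\<^sub>t - L \<theta>star - (2 g\<^sub>t - w\<^sub>t u\<^sub>t\<^sup>2)\<close>, summed over \<open>t > \<tau>\<close>, is a supermartingale, and Ville's
  inequality applies. Up to time \<open>\<tau>\<close> the risk is Lipschitz and the steps are bounded.
\<close>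

section \<open>Positive definite matrices and determinants\<close>

text \<open>The data need not follow a logistic model, so the variance of the score is not the
  curvature. The pointwise inequality \<open>logistic_deriv_sq_le\<close> replaces that identity,
  and with it come the factors \<open>exp (D * norm \<theta>star)\<close>: before the logarithm,
  where squared gradients are traded for the weights that build the information matrix, and in the
  scale \<open>1 / (64 * exp (D * norm \<theta>star))\<close> of the supermartingale exponent. The
  radius \<open>1 / (20 * D)\<close> keeps every margin within 1/20 of its value under
  \<open>\<theta>star\<close>, so that curvatures between the two margins agree up to the factor
  20/19. The convergence event speaks of all later times, and conditioning on it would destroy the
  independence of the next observation. Instead each factor of the supermartingale is set to 1 when
  the current state lies outside the ball or the time is not past \<open>\<tau>\<close>. This guard
  depends on the present state and time only, so the supermartingale lives on the whole space, and
  on the convergence event the guard never acts after \<open>\<tau>\<close>.\<close>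

lemma outer_mult_vec [simp]: "outer u v *v w = (v \<bullet> w) *\<^sub>R u"
  by (simp add: outer_def matrix_vector_mult_def vec_eq_iff inner_vec_def sum_distrib_left sum_distrib_right mult_ac)

lemma trace_outer: "trace (outer u v) = u \<bullet> v"
  by (simp add: outer_def trace_def inner_vec_def)

lemma matrix_mul_outer: "A ** outer u v = outer (A *v u) v"
  by (simp add: outer_def matrix_vector_mult_def matrix_matrix_mult_def vec_eq_iff sum_distrib_left mult_ac)

lemma outer_matrix_mul: "outer u v ** A = outer u (transpose A *v v)"
  by (simp add: outer_def matrix_vector_mult_def matrix_matrix_mult_def vec_eq_iff sum_distrib_left mult_ac transpose_def)

lemma matrix_add_rdistrib: "(A + B) ** C = A ** C + B ** C"
  by (simp add: matrix_matrix_mult_def vec_eq_iff distrib_right sum.distrib)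

lemma symmetric_dot:
  fixes A :: "real^'n^'n"
  assumes "transpose A = A"
  shows "u \<bullet> (A *v v) = (A *v u) \<bullet> v"
  using dot_lmul_matrix[of u A v] assms by (metis transpose_matrix_vector)

text \<open>An orthogonal change of basis that sends \<open>b\<close> to a multiple of a coordinate
  axis confines the rank-one term to one column. The result is the identity with one column
  replaced, the situation of Cramer's lemma.\<close>

lemma det_one_plus_outer:
  fixes a b :: "real^'n"
  shows "det (mat 1 + outer a b) = 1 + a \<bullet> b"
proof -
  fix k :: 'n
  have "norm b = norm (norm b *\<^sub>R axis k (1::real))"
    by (simp add: norm_axis_1)
  then have "\<exists>f. orthogonal_transformation f \<and> f b = norm b *\<^sub>R axis k (1::real)"
    by (rule orthogonal_transformation_exists) (rule exI, rule conjI)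
  then obtain f where f: "orthogonal_transformation f" "f b = norm b *\<^sub>R axis k (1::real)"
    by (elim exE conjE)
  define Q where "Q = matrix f"
  have Q: "orthogonal_matrix Q" and Qv: "\<And>v. Q *v v = f v"
    using f(1) unfolding Q_def orthogonal_transformation_matrix by (simp_all add: matrix_works)
  define c where "c = norm b *\<^sub>R f a"
  have dQ: "det Q * det (transpose Q) = 1"
    using Q by (metis det_I det_mul orthogonal_matrix_def)
  have QQ: "Q ** transpose Q = mat 1" using Q by (simp add: orthogonal_matrix_def)
  have "Q ** (mat 1 + outer a b) ** transpose Q = mat 1 + outer (f a) (f b)"
    by (simp add: matrix_add_ldistrib matrix_add_rdistrib matrix_mul_outer outer_matrix_mul Qv QQ)
  also have "\<dots> = (\<chi> i j. if j = k then (mat 1 *v (c + axis k 1)) $ i else mat 1 $ i $ j)"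
    unfolding matrix_vector_mul_lid by (auto simp: vec_eq_iff outer_def f c_def axis_def mat_def)
  finally have "det (Q ** (mat 1 + outer a b) ** transpose Q) = 1 + c $ k"
    by (simp only: cramer_lemma) (simp add: axis_def)
  moreover have "det (Q ** (mat 1 + outer a b) ** transpose Q) = det (mat 1 + outer a b)"
    using dQ by (simp add: det_mul)
  moreover have "c $ k = a \<bullet> b"
  proof -
    have "f a \<bullet> f b = a \<bullet> b" using f(1) by (simp add: orthogonal_transformation_def)
    then show ?thesis by (simp add: f c_def inner_axis)
  qed
  ultimately show ?thesis by simp
qed

section \<open>Spectral theorem for real symmetric matrices\<close>

lemma rayleigh_maximizer:
  fixes A :: "real^'n^'n"
  assumes sym: "transpose A = A" and W: "subspace W" "W \<noteq> {0}"
    and inv: "\<And>w. w \<in> W \<Longrightarrow> A *v w \<in> W"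
  obtains v k where "v \<in> W" "norm v = 1" "A *v v = k *\<^sub>R v"
    "\<And>w. w \<in> W \<Longrightarrow> w \<bullet> (A *v w) \<le> k * (w \<bullet> w)"
proof -
  obtain w0 where w0: "w0 \<in> W" "w0 \<noteq> 0"
    using W subspace_0 by blast
  define S where "S = W \<inter> sphere 0 1"
  have "compact S"
    unfolding S_def by (intro closed_Int_compact closed_subspace W compact_sphere)
  moreover have "(1 / norm w0) *\<^sub>R w0 \<in> S"
    using w0 W by (simp add: S_def subspace_scale)
  moreover have "continuous_on S (\<lambda>v. v \<bullet> (A *v v))"
    by (intro continuous_intros linear_continuous_on matrix_vector_mul_bounded_linear)
  ultimately obtain v where v: "v \<in> S" and max: "\<And>w. w \<in> S \<Longrightarrow> w \<bullet> (A *v w) \<le> v \<bullet> (A *v v)"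
    using continuous_attains_sup[of S "\<lambda>v. v \<bullet> (A *v v)"] by blast
  define k where "k = v \<bullet> (A *v v)"
  have vW: "v \<in> W" and vn: "norm v = 1" using v by (auto simp: S_def)
  then have vv: "v \<bullet> v = 1" by (simp add: dot_square_norm)
  have le: "w \<bullet> (A *v w) \<le> k * (w \<bullet> w)" if w: "w \<in> W" for w
  proof (cases "w = 0")
    case False
    have "(1 / norm w) *\<^sub>R w \<in> S" using w False W by (simp add: S_def subspace_scale)
    from max[OF this] have "w \<bullet> (A *v w) / (norm w)\<^sup>2 \<le> k"
      by (simp add: k_def matrix_vector_mult_scaleR power2_eq_square divide_simps)
    with False show ?thesis by (simp add: divide_simps dot_square_norm)
  qed simp
  define r where "r = A *v v - k *\<^sub>R v"
  have rW: "r \<in> W" unfolding r_def by (intro subspace_diff W inv vW subspace_scale)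
  define c where "c = k * (r \<bullet> r) - r \<bullet> (A *v r)"
  have c: "c \<ge> 0" using le[OF rW] by (simp add: c_def)
  have rv: "r \<bullet> (A *v v) = (r \<bullet> r) + k * (r \<bullet> v)"
    by (simp add: r_def inner_diff_right inner_diff_left algebra_simps)
  \<comment> \<open>First-order optimality along the residual \<open>r\<close>: a gain linear in
    \<open>s\<close> is set against a loss quadratic in \<open>s\<close>. For positive
    \<open>c\<close> the choice \<open>s = (r \<bullet> r) / c\<close> forces \<open>r\<close> to
    vanish; for \<open>c = 0\<close> any positive \<open>s\<close> does.\<close>
  have main: "2 * s * (r \<bullet> r) \<le> s\<^sup>2 * c" for s
  proof -
    have "v + s *\<^sub>R r \<in> W" by (intro subspace_add W vW subspace_scale rW)
    from le[OF this]
    have "k + 2 * s * (r \<bullet> (A *v v)) + s\<^sup>2 * (r \<bullet> (A *v r))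
       \<le> k * (1 + 2 * s * (r \<bullet> v) + s\<^sup>2 * (r \<bullet> r))"
      using symmetric_dot[OF sym, of v r] vn
      by (simp add: matrix_vector_right_distrib matrix_vector_mult_scaleR inner_add_left inner_add_right
          k_def[symmetric] vv inner_commute power2_eq_square)
        (simp add: algebra_simps inner_commute)
    then show ?thesis unfolding rv c_def by (simp add: algebra_simps)
  qed
  have "r \<bullet> r \<le> 0"
  proof (cases "c = 0")
    case True
    with main[of 1] show ?thesis by simp
  next
    case False
    with c have "c > 0" by simp
    with main[of "(r \<bullet> r) / c"] have "(r \<bullet> r)\<^sup>2 \<le> 0"
      by (simp add: power2_eq_square divide_simps)
    then show ?thesis by simp
  qed
  then have "r = 0" by (metis inner_ge_zero inner_eq_zero_iff order_antisym)
  then have "A *v v = k *\<^sub>R v" by (simp add: r_def)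
  with that vW vn le show ?thesis by blast
qed

text \<open>\<open>GREATEST\<close> says something only if a largest eigenvalue exists. The Rayleigh
  maximum over the whole space is attained at an eigenvector and dominates every other eigenvalue,
  so it is \<open>lambda_max A\<close>.\<close>

lemma quadratic_form_le_lambda_max:
  fixes A :: "real^'n^'n"
  assumes "transpose A = A"
  shows "v \<bullet> (A *v v) \<le> lambda_max A * (norm v)\<^sup>2"
proof -
  have "(UNIV :: (real^'n) set) \<noteq> {0}"
    by (metis UNIV_I axis_eq_0_iff singletonD zero_neq_one)
  then obtain q k where q: "norm q = 1" "A *v q = k *\<^sub>R q"
    and le: "\<And>w. w \<bullet> (A *v w) \<le> k * (w \<bullet> w)"
    using rayleigh_maximizer[OF assms subspace_UNIV] by (metis UNIV_I)
  have "lambda_max A = k"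
    unfolding lambda_max_def
  proof (rule Greatest_equality)
    show "is_eigenvalue A k" using q unfolding is_eigenvalue_def by (metis norm_zero zero_neq_one)
  next
    fix l assume "is_eigenvalue A l"
    then obtain w where w: "w \<noteq> 0" "A *v w = l *\<^sub>R w" by (auto simp: is_eigenvalue_def)
    with le[of w] have "l * (w \<bullet> w) \<le> k * (w \<bullet> w)" by simp
    with w show "l \<le> k" by simp
  qed
  with le[of v] show ?thesis by (simp add: dot_square_norm)
qed

lemma lambda_max_pos:
  fixes A :: "real^'n^'n"
  assumes "pos_def A"
  shows "lambda_max A > 0"
proof -
  let ?v = "axis undefined 1 :: real^'n"
  have "0 < ?v \<bullet> (A *v ?v)" using assms by (simp add: pos_def_def axis_eq_0_iff)
  also have "\<dots> \<le> lambda_max A"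
    using quadratic_form_le_lambda_max[of A ?v] assms by (simp add: pos_def_def norm_axis_1)
  finally show ?thesis .
qed

text \<open>Deflation, by induction on the index set: symmetry makes the orthogonal complement of
  the eigenvectors found so far invariant, a dimension count makes it non-zero, and the Rayleigh
  quotient is maximized on it.\<close>

lemma orthonormal_eigenvectors:
  fixes A :: "real^'n^'n"
  assumes sym: "transpose A = A"
  obtains q :: "'n \<Rightarrow> real^'n" and l :: "'n \<Rightarrow> real"
  where "\<And>i j. q i \<bullet> q j = (if i = j then 1 else 0)" "\<And>i. A *v q i = l i *\<^sub>R q i"
proof -
  have "\<exists>q l. (\<forall>i\<in>K. \<forall>j\<in>K. q i \<bullet> q j = (if i = j then 1 else 0)) \<and> (\<forall>i\<in>K. A *v q i = l i *\<^sub>R q i)"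
    for K :: "'n set"
    using finite[of K]
  proof (induction K rule: finite_induct)
    case (insert a K)
    then obtain q :: "'n \<Rightarrow> real^'n" and l where on: "\<And>i j. i \<in> K \<Longrightarrow> j \<in> K \<Longrightarrow> q i \<bullet> q j = (if i = j then 1 else 0)"
      and eig: "\<And>i. i \<in> K \<Longrightarrow> A *v q i = l i *\<^sub>R q i" by metis
    define W where "W = {w. \<forall>i\<in>K. q i \<bullet> w = 0}"
    have sub: "subspace W" by (simp add: W_def subspace_def inner_add_right)
    have "card (q ` K) < DIM(real^'n)"
    proof -
      have "card (q ` K) \<le> card K" by (simp add: card_image_le)
      also have "\<dots> < card (insert a K)" using insert by simp
      also have "\<dots> \<le> CARD('n)" by (rule card_mono) auto
      finally show ?thesis by simp
    qed
    then have "dim (span (q ` K)) < DIM(real^'n)"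
      by (metis dim_le_card dim_span finite_imageI finite le_less_trans order_refl span_superset)
    then obtain x where x: "x \<noteq> 0" "\<And>y. y \<in> span (q ` K) \<Longrightarrow> orthogonal x y"
      using orthogonal_to_subspace_exists[of "q ` K"] by (metis dim_span)
    have "x \<in> W" using x(2) by (auto simp: W_def orthogonal_def inner_commute[of _ x] span_base)
    with x(1) have ne: "W \<noteq> {0}" by auto
    have inv: "A *v w \<in> W" if "w \<in> W" for w
      using that eig by (simp add: W_def symmetric_dot[OF sym])
    obtain v k where v: "v \<in> W" "norm v = 1" "A *v v = k *\<^sub>R v"
      using rayleigh_maximizer[OF sym sub ne inv] by metis
    have vv: "v \<bullet> v = 1" using v(2) by (simp add: dot_square_norm)
    let ?q = "q(a := v)" and ?l = "l(a := k)"
    have "v \<bullet> q i = 0" "q i \<bullet> v = 0" if "i \<in> K" for i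
      using v(1) that by (auto simp: W_def inner_commute)
    then have "(\<forall>i\<in>insert a K. \<forall>j\<in>insert a K. ?q i \<bullet> ?q j = (if i = j then 1 else 0))
        \<and> (\<forall>i\<in>insert a K. A *v ?q i = ?l i *\<^sub>R ?q i)"
      using insert(2) on eig v(3) vv by auto
    then show ?case by blast
  qed simp
  from this[of UNIV] that show ?thesis by auto
qed

lemma symmetric_diagonalization:
  fixes A :: "real^'n^'n"
  assumes sym: "transpose A = A"
  obtains Q :: "real^'n^'n" and l where "orthogonal_matrix Q"
    "A = Q ** (\<chi> i j. if i = j then l i else 0) ** transpose Q"
    "\<And>i. \<exists>v. v \<noteq> 0 \<and> A *v v = l i *\<^sub>R v"
proof -
  obtain q :: "'n \<Rightarrow> real^'n" and l where on: "\<And>i j. q i \<bullet> q j = (if i = j then 1 else 0)"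
    and eig: "\<And>i. A *v q i = l i *\<^sub>R q i"
    using orthonormal_eigenvectors[OF sym] by blast
  define Q :: "real^'n^'n" where "Q = (\<chi> i j. q j $ i)"
  define L :: "real^'n^'n" where "L = (\<chi> i j. if i = j then l i else 0)"
  have "transpose Q ** Q = mat 1"
    using on by (simp add: Q_def transpose_def matrix_matrix_mult_def vec_eq_iff mat_def inner_vec_def)
  then have Q: "orthogonal_matrix Q" by (simp add: orthogonal_matrix)
  have "A ** Q = Q ** L"
  proof -
    have "(A ** Q) $ i $ j = (A *v q j) $ i" for i j
      by (simp add: Q_def matrix_matrix_mult_def matrix_vector_mult_def)
    moreover have "(Q ** L) $ i $ j = q j $ i * l j" for i j
      by (simp add: Q_def L_def matrix_matrix_mult_def if_distrib cong: if_cong)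
    ultimately show ?thesis by (simp add: eig vec_eq_iff mult.commute)
  qed
  then have "A = Q ** L ** transpose Q"
    using Q by (metis matrix_mul_assoc matrix_mul_rid orthogonal_matrix_def)
  moreover have "\<exists>v. v \<noteq> 0 \<and> A *v v = l i *\<^sub>R v" for i
    using eig[of i] on[of i i] by (intro exI[of _ "q i"]) auto
  ultimately show ?thesis using that Q unfolding L_def by blast
qed

section \<open>Determinant, trace and inverse of positive definite matrices\<close>

lemma pos_def_nonneg: "pos_def A \<Longrightarrow> 0 \<le> v \<bullet> (A *v v)"
  by (cases "v = 0") (auto simp: pos_def_def less_imp_le)

lemma pos_def_eigenvalue_pos:
  assumes "pos_def A" "v \<noteq> 0" "A *v v = k *\<^sub>R v"
  shows "k > 0"
proof -
  have "0 < k * (v \<bullet> v)" using assms by (auto simp: pos_def_def)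
  then show ?thesis using inner_ge_zero[of v] by (simp add: zero_less_mult_iff)
qed

lemma pos_def_factorization:
  fixes P :: "real^'n^'n"
  assumes "pos_def P"
  obtains R :: "real^'n^'n" where "P = R ** transpose R"
proof -
  have sym: "transpose P = P" using assms by (simp add: pos_def_def)
  obtain Q :: "real^'n^'n" and l where Q: "orthogonal_matrix Q"
    "P = Q ** (\<chi> i j. if i = j then l i else 0) ** transpose Q"
    "\<And>i. \<exists>v. v \<noteq> 0 \<and> P *v v = l i *\<^sub>R v"
    using symmetric_diagonalization[OF sym] by blast
  have l: "l i \<ge> 0" for i using pos_def_eigenvalue_pos[OF assms] Q(3)[of i] by force
  define S :: "real^'n^'n" where "S = (\<chi> i j. if i = j then sqrt (l i) else 0)"
  have "S ** transpose S = (\<chi> i j. if i = j then l i else 0)"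
  proof -
    have "(S ** transpose S) $ i $ j = (\<Sum>k\<in>UNIV. if k = i then if k = j then l k else 0 else 0)" for i j
      unfolding S_def transpose_def matrix_matrix_mult_def vec_lambda_beta
      using l by (intro sum.cong) auto
    then show ?thesis by (auto simp: vec_eq_iff)
  qed
  then have "P = (Q ** S) ** transpose (Q ** S)"
    by (simp add: Q(2) matrix_transpose_mul) (metis matrix_mul_assoc)
  with that show ?thesis by blast
qed

text \<open>The last part is the inequality of arithmetic and geometric means for the eigenvalues:
  \<open>ln\<close> lies below its tangent at the mean eigenvalue \<open>c\<close>, and the linear
  terms cancel in the sum.\<close>

lemma pos_def_ln_det_le:
  fixes A :: "real^'n^'n"
  assumes "pos_def A"
  shows "det A > 0" "trace A > 0" "ln (det A) \<le> CARD('n) * ln (trace A / CARD('n))"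
proof -
  have sym: "transpose A = A" using assms by (simp add: pos_def_def)
  obtain Q :: "real^'n^'n" and l where Q: "orthogonal_matrix Q"
    "A = Q ** (\<chi> i j. if i = j then l i else 0) ** transpose Q"
    "\<And>i. \<exists>v. v \<noteq> 0 \<and> A *v v = l i *\<^sub>R v"
    using symmetric_diagonalization[OF sym] by blast
  have l: "l i > 0" for i using pos_def_eigenvalue_pos[OF assms] Q(3)[of i] by force
  let ?L = "(\<chi> i j. if i = j then l i else 0) :: real^'n^'n"
  have "det A = det (transpose Q ** Q) * det ?L"
    by (simp add: Q(2) det_mul)
  then have "det A = det ?L" using Q(1) by (simp add: orthogonal_matrix_def)
  then have det: "det A = (\<Prod>i\<in>UNIV. l i)" by (simp add: det_diagonal)
  have "trace A = trace (transpose Q ** (Q ** ?L))" unfolding Q(2) by (rule trace_mul_sym)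
  also have "\<dots> = trace ?L" using Q(1) by (simp add: matrix_mul_assoc orthogonal_matrix_def)
  finally have tr: "trace A = (\<Sum>i\<in>UNIV. l i)" by (simp add: trace_def)
  show "det A > 0" using l by (simp add: det prod_pos)
  show tr_pos: "trace A > 0" using l by (simp add: tr sum_pos)
  define c where "c = trace A / CARD('n)"
  have c: "c > 0" using tr_pos by (simp add: c_def)
  have "ln (det A) = (\<Sum>i\<in>UNIV. ln (l i))" unfolding det using l by (intro ln_prod) (auto simp: less_imp_neq[THEN not_sym])
  also have "\<dots> \<le> (\<Sum>i\<in>(UNIV::'n set). ln c + (l i / c - 1))"
  proof (intro sum_mono)
    fix i
    have "ln (l i / c) \<le> l i / c - 1" using l c by (intro ln_le_minus_one) auto
    then show "ln (l i) \<le> ln c + (l i / c - 1)" using l[of i] c by (simp add: ln_div)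
  qed
  also have "\<dots> = CARD('n) * ln c + (trace A / c - CARD('n))"
    by (simp add: sum.distrib sum_subtractf tr sum_divide_distrib)
  also have "trace A / c = CARD('n)" using tr_pos by (simp add: c_def)
  finally show "ln (det A) \<le> CARD('n) * ln (trace A / CARD('n))" by (simp add: c_def)
qed

text \<open>\<open>P ** A\<close> need not be symmetric. With \<open>P = R ** transpose R\<close>,
  the congruent matrix \<open>transpose R ** A ** R\<close> is positive definite and has the same
  determinant and, by cyclicity, the same trace.\<close>

lemma pos_def_mult_ln_det_le:
  fixes P A :: "real^'n^'n"
  assumes P: "pos_def P" and A: "pos_def A"
  shows "ln (det P * det A) \<le> CARD('n) * ln (trace (P ** A) / CARD('n))"
proof -
  obtain R :: "real^'n^'n" where R: "P = R ** transpose R" using pos_def_factorization[OF P] .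
  define B where "B = transpose R ** A ** R"
  have "det R \<noteq> 0" using pos_def_ln_det_le(1)[OF P] by (auto simp: R det_mul)
  then have inj: "R *v v \<noteq> 0" if "v \<noteq> 0" for v
    using that by (metis invertible_det_nz invertible_left_inverse matrix_left_invertible_ker)
  have "pos_def B"
    unfolding pos_def_def
  proof safe
    show "transpose B = B"
      using A by (simp add: B_def matrix_transpose_mul pos_def_def matrix_mul_assoc)
    fix v :: "real^'n" assume "v \<noteq> 0"
    then have "0 < (R *v v) \<bullet> (A *v (R *v v))" using A inj by (simp add: pos_def_def)
    also have "\<dots> = v \<bullet> (B *v v)"
      unfolding B_def matrix_vector_mul_assoc[symmetric] transpose_matrix_vector
      by (metis dot_lmul_matrix inner_commute)
    finally show "0 < v \<bullet> (B *v v)" .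
  qed
  moreover have "det B = det P * det A" by (simp add: B_def R det_mul)
  moreover have "trace B = trace (P ** A)"
    unfolding B_def R by (metis matrix_mul_assoc trace_mul_sym)
  ultimately show ?thesis using pos_def_ln_det_le(3)[of B] by simp
qed

lemma pos_def_inverse:
  fixes P A :: "real^'n^'n"
  assumes A: "pos_def A" and PA: "P ** A = mat 1"
  shows "pos_def P"
  unfolding pos_def_def
proof safe
  have AP: "A ** P = mat 1" using PA by (simp add: matrix_left_right_inverse)
  have "A ** transpose P = mat 1"
    using arg_cong[OF PA, of transpose] A by (simp add: matrix_transpose_mul pos_def_def)
  then show "transpose P = P" using PA by (metis matrix_mul_assoc matrix_mul_lid matrix_mul_rid)
  fix v :: "real^'n" assume v: "v \<noteq> 0"
  have eq: "A *v (P *v v) = v" by (simp add: matrix_vector_mul_assoc AP)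
  with v have "P *v v \<noteq> 0" by auto
  then have "0 < (P *v v) \<bullet> (A *v (P *v v))" using A by (simp add: pos_def_def)
  with eq show "0 < v \<bullet> (P *v v)" by (simp add: inner_commute)
qed

lemma pos_def_matrix_inv:
  fixes P :: "real^'n^'n"
  assumes "pos_def P"
  shows "pos_def (matrix_inv P)" "P ** matrix_inv P = mat 1" "matrix_inv P ** P = mat 1"
proof -
  have "det P \<noteq> 0" using pos_def_ln_det_le(1)[OF assms] by simp
  then have i: "invertible P" by (simp add: invertible_det_nz)
  then show "P ** matrix_inv P = mat 1" "matrix_inv P ** P = mat 1"
    using someI_ex[of "\<lambda>B. P ** B = mat 1 \<and> B ** P = mat 1"]
    unfolding invertible_def matrix_inv_def by blast+
  then show "pos_def (matrix_inv P)" using pos_def_inverse[OF assms] by blast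
qed

text \<open>The form of \<open>P\<close> at \<open>k *\<^sub>R x - P *v x\<close> is nonnegative;
  expanding it and bounding the two pure quadratic terms gives the operator bound.\<close>

lemma pos_def_mult_vec_norm_le:
  fixes P :: "real^'n^'n"
  assumes P: "pos_def P" and le: "\<And>v. v \<bullet> (P *v v) \<le> k * (norm v)\<^sup>2" and k: "k > 0"
  shows "norm (P *v x) \<le> k * norm x"
proof -
  let ?z = "P *v x"
  have "0 \<le> (k *\<^sub>R x - ?z) \<bullet> (P *v (k *\<^sub>R x - ?z))" by (rule pos_def_nonneg[OF P])
  also have "\<dots> = k\<^sup>2 * (x \<bullet> ?z) - 2 * k * (norm ?z)\<^sup>2 + ?z \<bullet> (P *v ?z)"
    using symmetric_dot[of P x ?z] P
    by (simp add: pos_def_def matrix_vector_mult_diff_distrib matrix_vector_mult_scaleR inner_diff_left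
        inner_diff_right dot_square_norm power2_eq_square algebra_simps)
  also have "\<dots> \<le> k\<^sup>2 * (k * (norm x)\<^sup>2) - 2 * k * (norm ?z)\<^sup>2 + k * (norm ?z)\<^sup>2"
    using le[of x] le[of ?z] k by (intro add_mono diff_mono mult_left_mono) auto
  finally have "k * (norm ?z)\<^sup>2 \<le> k * (k * norm x)\<^sup>2"
    by (simp add: power_mult_distrib algebra_simps power2_eq_square)
  then have "(norm ?z)\<^sup>2 \<le> (k * norm x)\<^sup>2" using k by simp
  then show ?thesis using k by (simp add: power2_le_iff_abs_le)
qed

section \<open>Rank-one update of an inverse\<close>

lemma outer_conjugate_mult_vec:
  fixes P :: "real^'n^'n"
  assumes "transpose P = P"
  shows "(P ** outer x x ** P) *v w = (x \<bullet> (P *v w)) *\<^sub>R (P *v x)"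
  by (simp add: matrix_vector_mul_assoc[symmetric] matrix_vector_mult_scaleR)

text \<open>The filter's recursion for \<open>P\<close> has this form, which identifies
  \<open>P\<close> as the inverse of a matrix that grows additively with the observations. On a
  vector the claim reduces to the vanishing of one coefficient of \<open>P *v x\<close>.\<close>

lemma sherman_morrison:
  fixes P A :: "real^'n^'n"
  assumes sym: "transpose P = P" and PA: "P ** A = mat 1" and nz: "1 + (x \<bullet> (P *v x)) * a \<noteq> 0"
  shows "(P - (a / (1 + (x \<bullet> (P *v x)) * a)) *\<^sub>R (P ** outer x x ** P)) ** (A + a *\<^sub>R outer x x) = mat 1"
    (is "?P ** ?A = _")
proof -
  have "(?P ** ?A) *v v = v" for v
  proof -
    let ?q = "x \<bullet> (P *v x)" and ?c = "x \<bullet> v"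
    have PAv: "P *v (?A *v v) = v + (a * ?c) *\<^sub>R (P *v x)"
      by (simp add: matrix_vector_mult_add_rdistrib scaleR_matrix_vector_assoc[symmetric] matrix_vector_right_distrib
          matrix_vector_mult_scaleR matrix_vector_mul_assoc PA)
    have "(?P ** ?A) *v v = P *v (?A *v v) - (a / (1 + ?q * a)) *\<^sub>R ((x \<bullet> (P *v (?A *v v))) *\<^sub>R (P *v x))"
      unfolding matrix_vector_mul_assoc[of ?P ?A v, symmetric]
      by (simp only: matrix_vector_mult_diff_rdistrib scaleR_matrix_vector_assoc[symmetric] outer_conjugate_mult_vec[OF sym])
    also have "\<dots> = v + (a * ?c - a / (1 + ?q * a) * (?c * (1 + ?q * a))) *\<^sub>R (P *v x)"
      unfolding PAv by (simp add: inner_add_right scaleR_left_diff_distrib algebra_simps)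
    also have "\<dots> = v" using nz by simp
    finally show ?thesis .
  qed
  then show ?thesis by (simp add: matrix_eq)
qed

section \<open>The logistic loss\<close>

definition logistic_deriv :: "real \<Rightarrow> real \<Rightarrow> real" where
  "logistic_deriv y z = - y / (1 + exp (y * z))"

lemma abs_logistic_deriv_le:
  assumes "y \<in> {-1, 1}"
  shows "\<bar>logistic_deriv y z\<bar> \<le> 1"
  using assms add_pos_pos[OF zero_less_one exp_gt_zero[of z]] add_pos_pos[OF zero_less_one exp_gt_zero[of "-z"]]
  by (auto simp: logistic_deriv_def divide_simps)

lemma logistic_weight_pos: "logistic_weight \<theta> x > 0"
  by (simp add: logistic_weight_def add_pos_pos)

lemma logistic_weight_le: "logistic_weight \<theta> x \<le> 1 / 4"
proof -
  define a where "a = exp (\<theta> \<bullet> x)"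
  have a: "a > 0" by (simp add: a_def)
  have "(1 + a) * (1 + inverse a) = 2 + a + inverse a" using a by (simp add: field_simps)
  moreover have "a + inverse a \<ge> 2"
    using a zero_le_power2[of "a - 1"] by (simp add: field_simps power2_eq_square)
  ultimately have "(1 + exp (\<theta> \<bullet> x)) * (1 + exp (- (\<theta> \<bullet> x))) \<ge> 4"
    unfolding a_def[symmetric] exp_minus by simp
  then show ?thesis by (simp add: logistic_weight_def divide_simps)
qed

text \<open>The logistic weight as a function of the margin. It is the second derivative of the loss
  for either sign of the label, hence free of \<open>y\<close>.\<close>

definition logistic_var :: "real \<Rightarrow> real" where
  "logistic_var z = 1 / ((1 + exp z) * (1 + exp (- z)))"

lemma logistic_weight_eq: "logistic_weight \<theta> x = logistic_var (\<theta> \<bullet> x)"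
  by (simp add: logistic_weight_def logistic_var_def)

lemma logistic_var_eq: "logistic_var z = 1 / (2 + exp z + exp (- z))"
  by (simp add: logistic_var_def algebra_simps exp_minus)

lemma logistic_var_pos: "logistic_var z > 0"
  by (simp add: logistic_var_def add_pos_pos)

lemma logistic_var_le: "logistic_var z \<le> 1 / 4"
  using logistic_weight_le[of "z *\<^sub>R axis undefined 1" "axis undefined 1 :: real^1"]
  by (simp add: logistic_weight_eq inner_axis_axis)

lemma logistic_loss_nonneg: "logistic_loss y z \<ge> 0"
  by (simp add: logistic_loss_def)

lemma has_deriv_logistic_loss:
  "(logistic_loss y has_real_derivative logistic_deriv y z) (at z)"
proof -
  have p: "1 + exp (- y * z) > 0" by (simp add: add_pos_pos)
  define a where "a = exp (y * z)"
  have "a > 0" and "exp (- y * z) = inverse a" by (simp_all add: a_def exp_minus)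
  then have eq: "inverse (1 + exp (- y * z)) * (exp (- y * z) * - y) = logistic_deriv y z"
    using add_pos_pos[OF zero_less_one \<open>a > 0\<close>]
    by (simp only: logistic_deriv_def a_def[symmetric]) (simp add: field_simps)
  show ?thesis
    unfolding logistic_loss_def[abs_def] eq[symmetric]
    using p by (auto intro!: derivative_eq_intros simp: divide_inverse)
qed

lemma has_deriv_logistic_deriv:
  assumes "y \<in> {-1, 1}"
  shows "(logistic_deriv y has_real_derivative logistic_var z) (at z)"
proof -
  have p: "1 + exp (y * z) > 0" by (simp add: add_pos_pos)
  have h: "1 / ((1 + b) * (1 + inverse b)) = b / ((1 + b) * (1 + b))" if "b > 0" for b :: real
    using that add_pos_pos[OF zero_less_one that] by (simp add: field_simps)
  have "logistic_var z = exp (y * z) * y * y / ((1 + exp (y * z)) * (1 + exp (y * z)))"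
    using assms h[of "exp z"] h[of "exp (- z)"] exp_minus[of z] exp_minus[of "- z"]
    by (auto simp: logistic_var_def mult.commute)
  then show ?thesis
    unfolding logistic_deriv_def[abs_def]
    using p by (auto intro!: derivative_eq_intros simp: field_simps)
qed

text \<open>Self-concordance in integrated form: each term of \<open>2 + exp z + exp (- z)\<close>
  changes by at most the factor \<open>exp \<bar>z - z'\<bar>\<close>.\<close>

lemma logistic_var_ratio: "logistic_var z \<le> exp \<bar>z - z'\<bar> * logistic_var z'"
proof -
  let ?e = "exp \<bar>z - z'\<bar>"
  have "2 \<le> ?e * 2" by simp
  moreover have "exp z' \<le> ?e * exp z" "exp (- z') \<le> ?e * exp (- z)"
    unfolding exp_add[symmetric] by auto
  ultimately have "2 + exp z' + exp (- z') \<le> ?e * (2 + exp z + exp (- z))"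
    unfolding distrib_left by linarith
  then show ?thesis
    unfolding logistic_var_eq by (simp add: divide_simps add_pos_pos)
qed

text \<open>The expansion is about \<open>z'\<close>, later the margin under the minimizer, but the
  location of \<open>\<xi>\<close> is measured from \<open>z\<close>, the current margin, because
  the filter uses the curvature at \<open>z\<close>.\<close>

lemma logistic_loss_taylor:
  assumes y: "y \<in> {-1, 1}"
  obtains \<xi> where "\<bar>\<xi> - z\<bar> \<le> \<bar>z - z'\<bar>"
    "logistic_loss y z = logistic_loss y z' + logistic_deriv y z' * (z - z') + logistic_var \<xi> / 2 * (z - z')\<^sup>2"
proof (cases "z = z'")
  case True
  then show ?thesis using that[of z] by simp
next
  case False
  let ?d = "\<lambda>n. [logistic_loss y, logistic_deriv y, logistic_var] ! n"
  have "\<forall>m t. m < 2 \<and> min z z' \<le> t \<and> t \<le> max z z' \<longrightarrow> (?d m has_real_derivative ?d (Suc m) t) (at t)"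
    using has_deriv_logistic_loss has_deriv_logistic_deriv[OF y] by (auto simp: less_2_cases_iff)
  from Taylor[OF _ _ this, of "logistic_loss y" z' z] False
  obtain t where t: "if z < z' then z < t \<and> t < z' else z' < t \<and> t < z"
    "logistic_loss y z = (\<Sum>m<2. ?d m z' / fact m * (z - z') ^ m) + ?d 2 t / fact 2 * (z - z')\<^sup>2"
    by auto
  then show ?thesis
    by (intro that[of t]) (auto simp: numeral_2_eq_2 split: if_splits)
qed

lemma logistic_deriv_mvt:
  assumes y: "y \<in> {-1, 1}"
  obtains \<xi> where "\<bar>\<xi> - z\<bar> \<le> \<bar>z - z'\<bar>"
    "logistic_deriv y z = logistic_deriv y z' + logistic_var \<xi> * (z - z')"
proof -
  consider "z < z'" | "z = z'" | "z' < z" by linarith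
  then show ?thesis
  proof cases
    case 1
    from MVT2[OF this has_deriv_logistic_deriv[OF y]] obtain t where
      "z < t" "t < z'" "logistic_deriv y z' - logistic_deriv y z = (z' - z) * logistic_var t" by blast
    then show ?thesis by (intro that[of t]) (auto simp: algebra_simps)
  next
    case 2
    then show ?thesis using that[of z] by simp
  next
    case 3
    from MVT2[OF this has_deriv_logistic_deriv[OF y]] obtain t where
      "z' < t" "t < z" "logistic_deriv y z - logistic_deriv y z' = (z - z') * logistic_var t" by blast
    then show ?thesis by (intro that[of t]) (auto simp: algebra_simps)
  qed
qed

section \<open>Global and local bounds on the loss and its derivative\<close>

lemma logistic_loss_lipschitz:
  assumes y: "y \<in> {-1, 1}"
  shows "\<bar>logistic_loss y z - logistic_loss y z'\<bar> \<le> \<bar>z - z'\<bar>"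
proof -
  have "norm (logistic_loss y z - logistic_loss y z') \<le> 1 * norm (z - z')"
    by (rule field_differentiable_bound[of UNIV _ "logistic_deriv y"])
      (auto intro: has_field_derivative_at_within has_deriv_logistic_loss
        simp: abs_logistic_deriv_le[OF y])
  then show ?thesis by simp
qed

text \<open>The constant 1/8 is half the maximal curvature 1/4. Being global, the bound allows
  perturbations of \<open>\<theta>star\<close> of any length.\<close>

lemma logistic_loss_quadratic_upper:
  assumes y: "y \<in> {-1, 1}"
  shows "logistic_loss y z \<le> logistic_loss y z' + logistic_deriv y z' * (z - z') + (z - z')\<^sup>2 / 8"
proof -
  obtain \<xi> where eq: "logistic_loss y z
      = logistic_loss y z' + logistic_deriv y z' * (z - z') + logistic_var \<xi> / 2 * (z - z')\<^sup>2"
    using logistic_loss_taylor[OF y] by metis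
  have "logistic_var \<xi> / 2 * (z - z')\<^sup>2 \<le> (1 / 8) * (z - z')\<^sup>2"
    using logistic_var_le[of \<xi>] by (intro mult_right_mono) auto
  then show ?thesis unfolding eq by simp
qed

lemma exp_twentieth: "exp (1 / 20 :: real) \<le> 20 / 19"
proof -
  have "1 + (- 1 / 20) \<le> exp (- 1 / 20 :: real)" by (rule exp_ge_add_one_self)
  then show ?thesis by (simp add: exp_minus field_simps)
qed

lemma logistic_var_near:
  assumes "\<bar>z - z'\<bar> \<le> 1 / 20"
  shows "logistic_var z \<le> 20 / 19 * logistic_var z'"
proof -
  have "exp \<bar>z - z'\<bar> \<le> 20 / 19" using exp_twentieth assms by (metis exp_le_cancel_iff order_trans)
  then have "exp \<bar>z - z'\<bar> * logistic_var z' \<le> 20 / 19 * logistic_var z'"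
    using logistic_var_pos[of z'] by (intro mult_right_mono) auto
  with logistic_var_ratio[of z z'] show ?thesis by linarith
qed

text \<open>Half of the curvature ratio 20/19 is 10/19, rounded up to 53/100.\<close>

lemma logistic_loss_local_upper:
  assumes y: "y \<in> {-1, 1}" and u: "\<bar>z - z'\<bar> \<le> 1 / 20"
  shows "logistic_loss y z - logistic_loss y z'
    \<le> logistic_deriv y z' * (z - z') + 53 / 100 * (logistic_var z * (z - z')\<^sup>2)"
proof -
  obtain \<xi> where xi: "\<bar>\<xi> - z\<bar> \<le> \<bar>z - z'\<bar>" and eq: "logistic_loss y z
      = logistic_loss y z' + logistic_deriv y z' * (z - z') + logistic_var \<xi> / 2 * (z - z')\<^sup>2"
    using logistic_loss_taylor[OF y] by metis
  have "logistic_var \<xi> * (z - z')\<^sup>2 \<le> (20 / 19 * logistic_var z) * (z - z')\<^sup>2"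
    using xi u by (intro mult_right_mono logistic_var_near) auto
  moreover have "logistic_var z * (z - z')\<^sup>2 \<ge> 0" using logistic_var_pos[of z] by simp
  ultimately show ?thesis unfolding eq by (simp add: mult.assoc)
qed

text \<open>Moving the derivative from \<open>z\<close> to \<open>z'\<close> gains at least 19/20 of
  the curvature term. Doubled and reduced by one this is 9/10; the Taylor bound costs 53/100, and
  more than 3/10 remains. The linear term at \<open>z'\<close> has mean zero when \<open>z'\<close>
  is the margin under the minimizer, so in expectation the excess risk is isolated.\<close>

lemma logistic_loss_local_lower:
  assumes y: "y \<in> {-1, 1}" and u: "\<bar>z - z'\<bar> \<le> 1 / 20"
  shows "logistic_loss y z - logistic_loss y z' + logistic_deriv y z' * (z - z')
      + 3 / 10 * (logistic_var z * (z - z')\<^sup>2)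
    \<le> 2 * (logistic_deriv y z * (z - z')) - logistic_var z * (z - z')\<^sup>2"
proof -
  let ?w = "logistic_var z * (z - z')\<^sup>2"
  obtain \<xi> where xi: "\<bar>\<xi> - z\<bar> \<le> \<bar>z - z'\<bar>" and eq: "logistic_deriv y z = logistic_deriv y z' + logistic_var \<xi> * (z - z')"
    using logistic_deriv_mvt[OF y] by metis
  have "\<bar>z - \<xi>\<bar> \<le> 1 / 20" using xi u by linarith
  then have "logistic_var z * (z - z')\<^sup>2 \<le> (20 / 19 * logistic_var \<xi>) * (z - z')\<^sup>2"
    by (intro mult_right_mono logistic_var_near) auto
  then have "?w \<le> 20 / 19 * (logistic_var \<xi> * (z - z')\<^sup>2)" by (simp only: mult.assoc)
  moreover have "?w \<ge> 0" using logistic_var_pos[of z] by simp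
  moreover have "logistic_deriv y z * (z - z') = logistic_deriv y z' * (z - z') + logistic_var \<xi> * (z - z')\<^sup>2"
    unfolding eq by (simp add: algebra_simps power2_eq_square)
  ultimately show ?thesis using logistic_loss_local_upper[OF y u] by linarith
qed

text \<open>For a sign \<open>y\<close> the squared derivative equals \<open>exp (- (y * z))\<close>
  times the curvature. This pointwise comparison holds whatever the law of the label.\<close>

lemma logistic_deriv_sq_le:
  assumes "y \<in> {-1, 1}"
  shows "(logistic_deriv y z)\<^sup>2 \<le> exp \<bar>z\<bar> * logistic_var z"
proof -
  have sq: "(logistic_deriv y z)\<^sup>2 = exp (- (y * z)) * logistic_var (y * z)"
  proof -
    define a where "a = exp (y * z)"
    have "a > 0" by (simp add: a_def)
    moreover have "y\<^sup>2 = 1" using assms by auto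
    ultimately show ?thesis
      unfolding logistic_deriv_def logistic_var_def exp_minus a_def[symmetric]
      by (simp add: power_divide power2_eq_square divide_simps)
  qed
  have "logistic_var (y * z) = logistic_var z" using assms by (auto simp: logistic_var_eq)
  moreover have "exp (- (y * z)) \<le> exp \<bar>z\<bar>" using assms by auto
  ultimately show ?thesis unfolding sq using logistic_var_pos[of z] by simp
qed

lemma exp_le_quadratic:
  fixes x :: real
  assumes "\<bar>x\<bar> \<le> 1"
  shows "exp x \<le> 1 + x + x\<^sup>2"
proof (cases "x \<ge> 0")
  case True
  with assms show ?thesis by (intro exp_bound) auto
next
  case False
  have "1 - x \<le> exp (- x)" using exp_ge_add_one_self[of "- x"] by simp
  moreover have "1 \<le> (1 + x + x\<^sup>2) * (1 - x)"
  proof -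
    have "(1 + x + x\<^sup>2) * (1 - x) = 1 + (- x) ^ 3" by (simp add: algebra_simps power2_eq_square power3_eq_cube)
    then show ?thesis using False by simp
  qed
  moreover have pos: "1 + x + x\<^sup>2 > 0" using assms False
    by (smt (verit) power2_eq_square zero_less_power2)
  ultimately have "1 \<le> (1 + x + x\<^sup>2) * exp (- x)"
    by (meson less_imp_le mult_left_mono order_trans)
  then show ?thesis by (simp add: exp_minus divide_simps)
qed

section \<open>The filter along one trajectory\<close>

locale ekf_path =
  fixes \<beta> D :: real and P1 :: "real^'n^'n" and \<theta>1 :: "real^'n" and x :: "nat \<Rightarrow> real^'n"
    and y \<alpha> :: "nat \<Rightarrow> real" and P :: "nat \<Rightarrow> real^'n^'n" and \<theta> :: "nat \<Rightarrow> real^'n"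
  assumes ekf: "truncated_ekf \<beta> P1 \<theta>1 x y \<alpha> P \<theta>"
    and beta: "0 < \<beta>" and P1: "pos_def P1"
    and x_le: "\<And>t. t \<ge> 1 \<Longrightarrow> norm (x t) \<le> D" and y: "\<And>t. t \<ge> 1 \<Longrightarrow> y t \<in> {-1, 1}"
begin

definition info :: "nat \<Rightarrow> real^'n^'n" where
  "info t = matrix_inv P1 + (\<Sum>s = 1..<t. \<alpha> s *\<^sub>R outer (x s) (x s))"

lemma P_1: "P 1 = P1" and \<theta>_1: "\<theta> 1 = \<theta>1"
  and alpha: "t \<ge> 1 \<Longrightarrow> \<alpha> t = max (1 / real t powr \<beta>) (logistic_weight (\<theta> t) (x t))"
  and P_Suc: "t \<ge> 1 \<Longrightarrow> P (Suc t) = P t - (\<alpha> t / (1 + (x t \<bullet> (P t *v x t)) * \<alpha> t))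
      *\<^sub>R (P t ** outer (x t) (x t) ** P t)"
  and \<theta>_Suc: "t \<ge> 1 \<Longrightarrow> \<theta> (Suc t) = \<theta> t - logistic_deriv (y t) (\<theta> t \<bullet> x t) *\<^sub>R (P (Suc t) *v x t)"
  using ekf by (auto simp: truncated_ekf_def logistic_deriv_def matrix_vector_mult_scaleR)

lemma D_nonneg: "D \<ge> 0"
  using x_le[of 1] norm_ge_zero[of "x 1"] by linarith

lemma alpha_pos: "t \<ge> 1 \<Longrightarrow> \<alpha> t > 0"
  using logistic_weight_pos[of "\<theta> t" "x t"] by (simp add: alpha less_max_iff_disj)

lemma alpha_le_1: "t \<ge> 1 \<Longrightarrow> \<alpha> t \<le> 1"
  using logistic_weight_le[of "\<theta> t" "x t"] ge_one_powr_ge_zero[of "real t" \<beta>] beta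
  by (simp add: alpha divide_simps)

lemma info_Suc: "t \<ge> 1 \<Longrightarrow> info (Suc t) = info t + \<alpha> t *\<^sub>R outer (x t) (x t)"
  by (simp add: info_def)

text \<open>The three facts feed each other: positivity of \<open>P t\<close> keeps the denominator
  of the update non-zero, the product identity survives the update, and positivity of the new
  \<open>info\<close> passes to its inverse.\<close>

lemma invariants:
  assumes "t \<ge> 1"
  shows "pos_def (P t) \<and> P t ** info t = mat 1 \<and> pos_def (info t)"
  using assms
proof (induction t rule: dec_induct)
  case base
  then show ?case using P1 pos_def_matrix_inv[OF P1] P_1 by (simp add: info_def)
next
  case (step t)
  then have IH: "pos_def (P t)" "P t ** info t = mat 1" "pos_def (info t)" by auto
  have a: "\<alpha> t > 0" using alpha_pos step by simp
  have "0 \<le> (x t \<bullet> (P t *v x t)) * \<alpha> t" using a pos_def_nonneg[OF IH(1)] by simp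
  then have 1: "P (Suc t) ** info (Suc t) = mat 1"
    using sherman_morrison[of "P t" "info t" "x t" "\<alpha> t"] IH step
    by (simp add: P_Suc info_Suc pos_def_def)
  have "pos_def (info (Suc t))"
    unfolding pos_def_def
  proof safe
    show "transpose (info (Suc t)) = info (Suc t)"
      using IH(3) step by (simp add: info_Suc pos_def_def transpose_def outer_def vec_eq_iff)
    fix v :: "real^'n" assume "v \<noteq> 0"
    then have "0 < v \<bullet> (info t *v v)" using IH(3) by (simp add: pos_def_def)
    also have "\<dots> \<le> v \<bullet> (info t *v v) + \<alpha> t * (x t \<bullet> v)\<^sup>2" using a by simp
    also have "\<dots> = v \<bullet> (info (Suc t) *v v)"
      using step by (simp add: info_Suc matrix_vector_mult_add_rdistrib scaleR_matrix_vector_assoc[symmetric] inner_add_right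
          power2_eq_square inner_commute)
    finally show "0 < v \<bullet> (info (Suc t) *v v)" .
  qed
  with 1 pos_def_inverse show ?case by blast
qed

section \<open>Deterministic bounds along the trajectory\<close>

lemma P_pos_def: "t \<ge> 1 \<Longrightarrow> pos_def (P t)"
  and info_pos_def: "t \<ge> 1 \<Longrightarrow> pos_def (info t)"
  and P_info: "t \<ge> 1 \<Longrightarrow> P t ** info t = mat 1"
  and info_P: "t \<ge> 1 \<Longrightarrow> info t ** P t = mat 1"
  using invariants matrix_left_right_inverse by blast+

text \<open>Each update subtracts a positive semidefinite matrix, so the form of \<open>P\<close>
  only decreases from that of \<open>P1\<close>.\<close>

lemma P_form_le:
  assumes "t \<ge> 1"
  shows "v \<bullet> (P t *v v) \<le> lambda_max P1 * (norm v)\<^sup>2"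
  using assms
proof (induction t rule: dec_induct)
  case base
  show ?case using quadratic_form_le_lambda_max[of P1 v] P1 P_1 by (simp add: pos_def_def)
next
  case (step t)
  have sym: "transpose (P t) = P t" using P_pos_def step by (simp add: pos_def_def)
  let ?c = "\<alpha> t / (1 + (x t \<bullet> (P t *v x t)) * \<alpha> t)"
  have "?c \<ge> 0" using alpha_pos[of t] pos_def_nonneg[OF P_pos_def, of t "x t"] step
    by (intro divide_nonneg_nonneg add_nonneg_nonneg mult_nonneg_nonneg) auto
  moreover have "v \<bullet> (P (Suc t) *v v) = v \<bullet> (P t *v v) - ?c * (x t \<bullet> (P t *v v))\<^sup>2"
    using step symmetric_dot[OF sym, of v "x t"]
    by (simp add: P_Suc matrix_vector_mult_diff_rdistrib scaleR_matrix_vector_assoc[symmetric] inner_diff_right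
        outer_conjugate_mult_vec[OF sym] power2_eq_square inner_commute)
  moreover from calculation have "?c * (x t \<bullet> (P t *v v))\<^sup>2 \<ge> 0" by (intro mult_nonneg_nonneg) auto
  ultimately have "v \<bullet> (P (Suc t) *v v) \<le> v \<bullet> (P t *v v)" by linarith
  with step.IH show ?case by simp
qed

lemma lambda_max_P1_pos: "lambda_max P1 > 0"
  using P1 by (rule lambda_max_pos)

lemma norm_step_le:
  assumes "t \<ge> 1"
  shows "norm (\<theta> (Suc t) - \<theta> t) \<le> lambda_max P1 * D"
proof -
  have "norm (\<theta> (Suc t) - \<theta> t) = \<bar>logistic_deriv (y t) (\<theta> t \<bullet> x t)\<bar> * norm (P (Suc t) *v x t)"
    using assms by (simp add: \<theta>_Suc)
  also have "\<dots> \<le> 1 * (lambda_max P1 * norm (x t))"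
    using assms by (intro mult_mono abs_logistic_deriv_le y pos_def_mult_vec_norm_le P_pos_def P_form_le lambda_max_P1_pos) auto
  also have "\<dots> \<le> lambda_max P1 * D"
    using x_le[OF assms] lambda_max_P1_pos by simp
  finally show ?thesis .
qed

lemma norm_dist_le:
  assumes "t \<ge> 1"
  shows "norm (\<theta> t - \<theta>') \<le> norm (\<theta>1 - \<theta>') + (real t - 1) * (lambda_max P1 * D)"
  using assms
proof (induction t rule: dec_induct)
  case base
  show ?case using \<theta>_1 by simp
next
  case (step t)
  have "norm (\<theta> (Suc t) - \<theta>') \<le> norm (\<theta> t - \<theta>') + norm (\<theta> (Suc t) - \<theta> t)"
    using norm_triangle_ineq[of "\<theta> t - \<theta>'" "\<theta> (Suc t) - \<theta> t"] by simp
  with step norm_step_le[of t] show ?case by (simp add: algebra_simps)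
qed

text \<open>The error is measured in the inverse of the gain \<open>P (Suc t)\<close>. The gain then
  cancels in the cross term, leaving the plain directional derivative
  \<open>d * (e \<bullet> x t)\<close> and a single quadratic remainder.\<close>

lemma energy_Suc:
  fixes \<theta>' :: "real^'n"
  assumes t: "t \<ge> 1"
  defines "e \<equiv> \<theta> t - \<theta>'" and "d \<equiv> logistic_deriv (y t) (\<theta> t \<bullet> x t)"
  shows "(\<theta> (Suc t) - \<theta>') \<bullet> (info (Suc t) *v (\<theta> (Suc t) - \<theta>'))
    = e \<bullet> (info t *v e) + \<alpha> t * (e \<bullet> x t)\<^sup>2 - 2 * (d * (e \<bullet> x t)) + d\<^sup>2 * (x t \<bullet> (P (Suc t) *v x t))"
proof -
  let ?P = "P (Suc t)" and ?A = "info (Suc t)"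
  have e': "\<theta> (Suc t) - \<theta>' = e - d *\<^sub>R (?P *v x t)" using t by (simp add: \<theta>_Suc e_def d_def)
  have AP: "?A *v (?P *v x t) = x t" by (simp add: matrix_vector_mul_assoc info_P)
  have "(?P *v x t) \<bullet> (?A *v e) = x t \<bullet> e"
    using symmetric_dot[of ?A "?P *v x t" e] info_pos_def[of "Suc t"] by (simp add: AP pos_def_def)
  moreover have "e \<bullet> (?A *v e) = e \<bullet> (info t *v e) + \<alpha> t * (e \<bullet> x t)\<^sup>2"
    using t by (simp add: info_Suc matrix_vector_mult_add_rdistrib scaleR_matrix_vector_assoc[symmetric] inner_add_right
          power2_eq_square inner_commute)
  ultimately show ?thesis
    unfolding e' matrix_vector_mult_diff_distrib matrix_vector_mult_scaleR AP
    by (simp add: inner_diff_left inner_diff_right inner_commute power2_eq_square algebra_simps)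
qed

text \<open>The energy identity telescopes, and the final energy is dropped because it is
  nonnegative. The case \<open>m = Suc n\<close> is the empty sum.\<close>

lemma energy_sum:
  assumes "m \<ge> 1" "m \<le> Suc n"
  shows "(\<Sum>t = m..n. 2 * (logistic_deriv (y t) (\<theta> t \<bullet> x t) * ((\<theta> t - \<theta>') \<bullet> x t)) - \<alpha> t * ((\<theta> t - \<theta>') \<bullet> x t)\<^sup>2)
    \<le> (\<theta> m - \<theta>') \<bullet> (info m *v (\<theta> m - \<theta>'))
      + (\<Sum>t = m..n. (logistic_deriv (y t) (\<theta> t \<bullet> x t))\<^sup>2 * (x t \<bullet> (P (Suc t) *v x t)))"
proof -
  let ?E = "\<lambda>t. (\<theta> t - \<theta>') \<bullet> (info t *v (\<theta> t - \<theta>'))"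
  have "(\<Sum>t = m..n. 2 * (logistic_deriv (y t) (\<theta> t \<bullet> x t) * ((\<theta> t - \<theta>') \<bullet> x t)) - \<alpha> t * ((\<theta> t - \<theta>') \<bullet> x t)\<^sup>2)
    = (\<Sum>t = m..n. - (?E (Suc t) - ?E t) + (logistic_deriv (y t) (\<theta> t \<bullet> x t))\<^sup>2 * (x t \<bullet> (P (Suc t) *v x t)))"
    using assms by (intro sum.cong refl) (simp add: energy_Suc)
  also have "\<dots> = - (?E (Suc n) - ?E m) + (\<Sum>t = m..n. (logistic_deriv (y t) (\<theta> t \<bullet> x t))\<^sup>2 * (x t \<bullet> (P (Suc t) *v x t)))"
    using sum_Suc_diff[of m n ?E] assms unfolding sum.distrib sum_negf by simp
  finally show ?thesis
    using pos_def_nonneg[OF info_pos_def, of "Suc n" "\<theta> (Suc n) - \<theta>'"] by linarith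
qed

lemma info_form_le:
  assumes "t \<ge> 1"
  shows "v \<bullet> (info t *v v) \<le> (lambda_max (matrix_inv P1) + (real t - 1) * D\<^sup>2) * (norm v)\<^sup>2"
  using assms
proof (induction t rule: dec_induct)
  case base
  show ?case using quadratic_form_le_lambda_max[of "matrix_inv P1" v] pos_def_matrix_inv(1)[OF P1]
    by (simp add: pos_def_def info_def)
next
  case (step t)
  have "\<bar>x t \<bullet> v\<bar> \<le> D * norm v"
    using Cauchy_Schwarz_ineq2[of "x t" v] x_le[of t] step by (meson mult_right_mono norm_ge_zero order_trans)
  then have "(x t \<bullet> v)\<^sup>2 \<le> (D * norm v)\<^sup>2" by (metis abs_ge_zero power2_abs power_mono)
  then have "\<alpha> t * (x t \<bullet> v)\<^sup>2 \<le> 1 * (D * norm v)\<^sup>2"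
    using alpha_le_1[of t] alpha_pos[of t] step by (intro mult_mono) auto
  with step show ?case
    by (simp add: info_Suc matrix_vector_mult_add_rdistrib scaleR_matrix_vector_assoc[symmetric] inner_add_right
        power2_eq_square inner_commute algebra_simps)
qed

text \<open>The elliptic potential argument, run backwards: removing the observation from
  \<open>info (Suc t)\<close> multiplies its determinant by \<open>1 - s\<close>, where
  \<open>s\<close> is the left-hand side, and \<open>ln (1 - s)\<close> is at most
  \<open>- s\<close>. Going backwards makes the updated \<open>P (Suc t)\<close> appear
  directly.\<close>

lemma weighted_form_le_ln_det:
  assumes t: "t \<ge> 1"
  shows "\<alpha> t * (x t \<bullet> (P (Suc t) *v x t)) \<le> ln (det (info (Suc t))) - ln (det (info t))"
proof -
  let ?P = "P (Suc t)" and ?A = "info (Suc t)"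
  let ?s = "\<alpha> t * (x t \<bullet> (?P *v x t))"
  have eq: "info t = ?A ** (mat 1 + outer ((- \<alpha> t) *\<^sub>R (?P *v x t)) (x t))"
  proof -
    have "?A *v (?P *v x t) = x t" by (simp add: matrix_vector_mul_assoc info_P)
    then have "?A ** (mat 1 + outer ((- \<alpha> t) *\<^sub>R (?P *v x t)) (x t)) = ?A + outer ((- \<alpha> t) *\<^sub>R x t) (x t)"
      by (simp only: matrix_add_ldistrib matrix_mul_outer matrix_vector_mult_scaleR matrix_mul_rid)
    with t show ?thesis by (simp add: info_Suc) (simp add: outer_def vec_eq_iff)
  qed
  have det: "det (info t) = det ?A * (1 - ?s)"
    unfolding eq det_mul det_one_plus_outer by (simp add: inner_commute)
  have pos: "det (info t) > 0" "det ?A > 0"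
    using t pos_def_ln_det_le(1) info_pos_def by auto
  then have s: "1 - ?s > 0" unfolding det by (simp add: zero_less_mult_iff)
  have "ln (det (info t)) = ln (det ?A) + ln (1 - ?s)"
    unfolding det using pos s by (intro ln_mult_pos)
  with ln_le_minus_one[OF s] show ?thesis by simp
qed

lemma info_split:
  assumes "m \<ge> 1" "m \<le> Suc n"
  shows "info (Suc n) = info m + (\<Sum>t = m..n. \<alpha> t *\<^sub>R outer (x t) (x t))"
proof -
  have "{1..<Suc n} = {1..<m} \<union> {m..n}" "{1..<m} \<inter> {m..n} = {}" using assms by auto
  then show ?thesis by (simp add: info_def sum.union_disjoint add.assoc)
qed

text \<open>The log-determinants telescope. Normalizing by \<open>P m\<close> turns their difference
  into \<open>ln (det (P m) * det (info (Suc n)))\<close>, which is bounded through the trace: the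
  dimension plus at most \<open>lambda_max P1 * D\<^sup>2 / 4\<close> per observation.\<close>

lemma sum_weighted_form_le:
  assumes m: "m \<ge> 1" "m \<le> Suc n" and a: "\<And>t. m \<le> t \<Longrightarrow> t \<le> n \<Longrightarrow> \<alpha> t \<le> 1 / 4"
  shows "(\<Sum>t = m..n. \<alpha> t * (x t \<bullet> (P (Suc t) *v x t)))
    \<le> CARD('n) * ln (1 + real (Suc n - m) * (lambda_max P1 * D\<^sup>2 / (4 * real CARD('n))))"
proof -
  have "(\<Sum>t = m..n. \<alpha> t * (x t \<bullet> (P (Suc t) *v x t))) \<le> (\<Sum>t = m..n. ln (det (info (Suc t))) - ln (det (info t)))"
    using m by (intro sum_mono weighted_form_le_ln_det) auto
  also have "\<dots> = ln (det (info (Suc n))) - ln (det (info m))"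
    using m by (intro sum_Suc_diff) auto
  also have "\<dots> = ln (det (P m) * det (info (Suc n)))"
  proof -
    have "det (P m) * det (info m) = 1" using P_info[OF m(1)] by (metis det_I det_mul)
    moreover have "det (info m) > 0" "det (info (Suc n)) > 0"
      using m by (intro pos_def_ln_det_le(1) info_pos_def; simp)+
    ultimately have "det (P m) * det (info (Suc n)) = det (info (Suc n)) / det (info m)"
      "det (info m) > 0" "det (info (Suc n)) > 0" by (auto simp: field_simps)
    then show ?thesis by (simp add: ln_div)
  qed
  also have "\<dots> \<le> CARD('n) * ln (trace (P m ** info (Suc n)) / CARD('n))"
    using m by (intro pos_def_mult_ln_det_le P_pos_def info_pos_def) auto
  also have "trace (P m ** info (Suc n)) = CARD('n) + (\<Sum>t = m..n. \<alpha> t * (x t \<bullet> (P m *v x t)))"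
  proof -
    have *: "trace (P m ** (\<Sum>t\<in>T. \<alpha> t *\<^sub>R outer (x t) (x t))) = (\<Sum>t\<in>T. \<alpha> t * (x t \<bullet> (P m *v x t)))"
      if "finite T" for T
      using that
    proof (induction T rule: finite_induct)
      case empty
      show ?case by (simp add: trace_def matrix_matrix_mult_def)
    next
      case (insert t T)
      have "P m ** (\<alpha> t *\<^sub>R outer (x t) (x t)) = outer (\<alpha> t *\<^sub>R (P m *v x t)) (x t)"
        using matrix_mul_outer[of "P m" "\<alpha> t *\<^sub>R x t" "x t"]
        by (simp add: matrix_vector_mult_scaleR) (simp add: outer_def vec_eq_iff matrix_matrix_mult_def mult.assoc)
      with insert show ?case
        by (simp add: matrix_add_ldistrib trace_add trace_outer inner_commute)
    qed
    show ?thesis using m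
      by (simp add: info_split[OF m] matrix_add_ldistrib trace_add P_info * trace_I)
  qed
  also have "CARD('n) * ln ((CARD('n) + (\<Sum>t = m..n. \<alpha> t * (x t \<bullet> (P m *v x t)))) / CARD('n))
    \<le> CARD('n) * ln (1 + real (Suc n - m) * (lambda_max P1 * D\<^sup>2 / (4 * real CARD('n))))"
  proof -
    have "(\<Sum>t = m..n. \<alpha> t * (x t \<bullet> (P m *v x t))) \<le> (\<Sum>t = m..n. 1 / 4 * (lambda_max P1 * D\<^sup>2))"
    proof (intro sum_mono mult_mono)
      fix t assume t: "t \<in> {m..n}"
      show "\<alpha> t \<le> 1 / 4" using a t by simp
      have "x t \<bullet> (P m *v x t) \<le> lambda_max P1 * (norm (x t))\<^sup>2" using P_form_le m by simp
      also have "\<dots> \<le> lambda_max P1 * D\<^sup>2"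
        using x_le[of t] t m lambda_max_P1_pos by (intro mult_left_mono power_mono) auto
      finally show "x t \<bullet> (P m *v x t) \<le> lambda_max P1 * D\<^sup>2" .
      show "0 \<le> x t \<bullet> (P m *v x t)" using m by (intro pos_def_nonneg P_pos_def)
    qed simp
    then have le: "(\<Sum>t = m..n. \<alpha> t * (x t \<bullet> (P m *v x t))) \<le> real (Suc n - m) * (lambda_max P1 * D\<^sup>2 / 4)"
      by simp
    have nn: "0 \<le> (\<Sum>t = m..n. \<alpha> t * (x t \<bullet> (P m *v x t)))"
      using m by (intro sum_nonneg mult_nonneg_nonneg less_imp_le[OF alpha_pos] pos_def_nonneg P_pos_def) auto
    have "(CARD('n) + (\<Sum>t = m..n. \<alpha> t * (x t \<bullet> (P m *v x t)))) / CARD('n)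
      = 1 + (\<Sum>t = m..n. \<alpha> t * (x t \<bullet> (P m *v x t))) / CARD('n)" by (simp add: add_divide_distrib)
    also have "\<dots> \<le> 1 + real (Suc n - m) * (lambda_max P1 * D\<^sup>2 / 4) / CARD('n)"
      using le by (intro add_left_mono divide_right_mono) auto
    finally have "(CARD('n) + (\<Sum>t = m..n. \<alpha> t * (x t \<bullet> (P m *v x t)))) / CARD('n)
      \<le> 1 + real (Suc n - m) * (lambda_max P1 * D\<^sup>2 / (4 * real CARD('n)))" by simp
    moreover have "0 < (CARD('n) + (\<Sum>t = m..n. \<alpha> t * (x t \<bullet> (P m *v x t)))) / CARD('n)"
      using nn by (intro divide_pos_pos add_pos_nonneg) auto
    ultimately show ?thesis by (intro mult_left_mono) (auto simp: ln_mono)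
  qed
  finally show ?thesis .
qed

text \<open>The distance to \<open>\<theta>star\<close> grows by at most
  \<open>lambda_max P1 * D\<close> per step, so the excess risks sum to an arithmetic series, whence
  the square. Allowing \<open>k\<close> below \<open>T\<close> also serves horizons that end inside
  the burn-in.\<close>

lemma burn_in_sum_le:
  fixes L :: "real^'n \<Rightarrow> real"
  assumes lip: "\<And>\<theta>'. L \<theta>' - L \<theta>star \<le> D * norm (\<theta>' - \<theta>star)" and k: "k \<le> T"
  shows "(\<Sum>t = 1..k. L (\<theta> t) - L \<theta>star)
    \<le> real T * (D * norm (\<theta>1 - \<theta>star)) + (real T)\<^sup>2 * (lambda_max P1 * D\<^sup>2 / 2)"
proof -
  let ?e = "D * norm (\<theta>1 - \<theta>star)" and ?l = "lambda_max P1 * D\<^sup>2"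
  have l: "?l \<ge> 0" using lambda_max_P1_pos by simp
  have "(\<Sum>t = 1..k. L (\<theta> t) - L \<theta>star) \<le> real k * ?e + (real k)\<^sup>2 * (?l / 2)"
  proof (induction k)
    case (Suc k)
    have "L (\<theta> (Suc k)) - L \<theta>star \<le> D * norm (\<theta> (Suc k) - \<theta>star)" by (rule lip)
    also have "\<dots> \<le> D * (norm (\<theta>1 - \<theta>star) + (real (Suc k) - 1) * (lambda_max P1 * D))"
      using D_nonneg by (intro mult_left_mono norm_dist_le) auto
    also have "\<dots> = ?e + real k * ?l" by (simp add: algebra_simps power2_eq_square)
    finally have "(\<Sum>t = 1..Suc k. L (\<theta> t) - L \<theta>star) \<le> real k * ?e + (real k)\<^sup>2 * (?l / 2) + (?e + real k * ?l)"
      using Suc.IH by simp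
    also have "\<dots> \<le> real (Suc k) * ?e + (real (Suc k))\<^sup>2 * (?l / 2)"
    proof -
      have "(real (Suc k))\<^sup>2 * (?l / 2) = (real k)\<^sup>2 * (?l / 2) + real k * ?l + ?l / 2"
        by (simp add: power2_eq_square field_simps)
      moreover have "real (Suc k) * ?e = real k * ?e + ?e" by (simp add: distrib_right)
      ultimately show ?thesis using l by linarith
    qed
    finally show ?case .
  qed simp
  also have "\<dots> \<le> real T * ?e + (real T)\<^sup>2 * (?l / 2)"
    using k l D_nonneg by (intro add_mono mult_right_mono power_mono) auto
  finally show ?thesis by simp
qed

lemma converged_sum_le:
  assumes D: "D > 0" and T: "T \<le> n"
    and near: "\<And>t. t > T \<Longrightarrow> norm (\<theta> t - \<theta>star) \<le> 1 / (20 * D) \<and> \<alpha> t = logistic_weight (\<theta> t) (x t)"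
  shows "(\<Sum>t = Suc T..n. 2 * (logistic_deriv (y t) (\<theta> t \<bullet> x t) * ((\<theta> t - \<theta>star) \<bullet> x t))
      - logistic_weight (\<theta> t) (x t) * ((\<theta> t - \<theta>star) \<bullet> x t)\<^sup>2)
    \<le> 3 * real CARD('n) * exp (D * norm \<theta>star) * ln (1 + real n * (lambda_max P1 * D\<^sup>2 / (4 * real CARD('n))))
      + lambda_max (matrix_inv P1) / (75 * D\<^sup>2) + real T / 300"
proof -
  let ?K = "exp (D * norm \<theta>star)" and ?\<Lambda> = "lambda_max (matrix_inv P1)"
  let ?q = "\<lambda>t. x t \<bullet> (P (Suc t) *v x t)"
  have \<Lambda>: "?\<Lambda> > 0" by (intro lambda_max_pos pos_def_matrix_inv P1)
  have "(\<Sum>t = Suc T..n. 2 * (logistic_deriv (y t) (\<theta> t \<bullet> x t) * ((\<theta> t - \<theta>star) \<bullet> x t))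
      - logistic_weight (\<theta> t) (x t) * ((\<theta> t - \<theta>star) \<bullet> x t)\<^sup>2)
    = (\<Sum>t = Suc T..n. 2 * (logistic_deriv (y t) (\<theta> t \<bullet> x t) * ((\<theta> t - \<theta>star) \<bullet> x t))
      - \<alpha> t * ((\<theta> t - \<theta>star) \<bullet> x t)\<^sup>2)"
    using near by (intro sum.cong) auto
  also have "\<dots> \<le> (\<theta> (Suc T) - \<theta>star) \<bullet> (info (Suc T) *v (\<theta> (Suc T) - \<theta>star))
      + (\<Sum>t = Suc T..n. (logistic_deriv (y t) (\<theta> t \<bullet> x t))\<^sup>2 * ?q t)"
    using T by (intro energy_sum) auto
  \<comment> \<open>Squaring the radius \<open>1 / (20 * D)\<close> gives the factor 1/400 in both
    terms; 1/75 and 1/300 are weaker. The count is \<open>T\<close> because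
    \<open>info (Suc T)\<close> contains the observations 1 to \<open>T\<close>.\<close>
  also have "(\<theta> (Suc T) - \<theta>star) \<bullet> (info (Suc T) *v (\<theta> (Suc T) - \<theta>star)) \<le> ?\<Lambda> / (75 * D\<^sup>2) + real T / 300"
  proof -
    have "(\<theta> (Suc T) - \<theta>star) \<bullet> (info (Suc T) *v (\<theta> (Suc T) - \<theta>star))
      \<le> (?\<Lambda> + real T * D\<^sup>2) * (norm (\<theta> (Suc T) - \<theta>star))\<^sup>2"
      using info_form_le[of "Suc T"] by simp
    also have "\<dots> \<le> (?\<Lambda> + real T * D\<^sup>2) * (1 / (20 * D))\<^sup>2"
      using near[of "Suc T"] \<Lambda> by (intro mult_left_mono power_mono) auto
    also have "\<dots> = ?\<Lambda> / (400 * D\<^sup>2) + real T / 400"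
      using D by (simp add: field_simps power2_eq_square)
    also have "\<dots> \<le> ?\<Lambda> / (75 * D\<^sup>2) + real T / 300"
      using D \<Lambda> by (intro add_mono divide_left_mono) auto
    finally show ?thesis .
  qed
  also have "(\<Sum>t = Suc T..n. (logistic_deriv (y t) (\<theta> t \<bullet> x t))\<^sup>2 * ?q t)
      \<le> 3 * real CARD('n) * ?K * ln (1 + real n * (lambda_max P1 * D\<^sup>2 / (4 * real CARD('n))))"
  proof -
    have q: "?q t \<ge> 0" for t by (intro pos_def_nonneg P_pos_def) simp
    \<comment> \<open>Squared gradients are exchanged for the weights \<alpha>. The price
      \<open>exp \<bar>\<theta> t \<bullet> x t\<bar>\<close> is at most
      \<open>20 / 19 * ?K\<close>, since the margin exceeds \<open>D * norm \<theta>star\<close> by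
      at most 1/20.\<close>
    have "(\<Sum>t = Suc T..n. (logistic_deriv (y t) (\<theta> t \<bullet> x t))\<^sup>2 * ?q t) \<le> (\<Sum>t = Suc T..n. (20 / 19 * ?K * \<alpha> t) * ?q t)"
    proof (intro sum_mono mult_right_mono q)
      fix t assume t: "t \<in> {Suc T..n}"
      have "(logistic_deriv (y t) (\<theta> t \<bullet> x t))\<^sup>2 \<le> exp \<bar>\<theta> t \<bullet> x t\<bar> * logistic_var (\<theta> t \<bullet> x t)"
        using t by (intro logistic_deriv_sq_le y) auto
      also have "\<dots> \<le> (20 / 19 * ?K) * logistic_var (\<theta> t \<bullet> x t)"
      proof (intro mult_right_mono less_imp_le[OF logistic_var_pos])
        have "\<bar>\<theta> t \<bullet> x t\<bar> \<le> norm (\<theta> t) * norm (x t)" by (rule Cauchy_Schwarz_ineq2)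
        also have "\<dots> \<le> (norm \<theta>star + 1 / (20 * D)) * D"
          using near[of t] t x_le[of t] D norm_triangle_ineq2[of "\<theta> t" \<theta>star] by (intro mult_mono) auto
        also have "\<dots> = D * norm \<theta>star + 1 / 20" using D by (simp add: field_simps)
        finally have "exp \<bar>\<theta> t \<bullet> x t\<bar> \<le> ?K * exp (1 / 20)" by (simp add: exp_add[symmetric])
        also have "\<dots> \<le> ?K * (20 / 19)" using exp_twentieth by (intro mult_left_mono) auto
        finally show "exp \<bar>\<theta> t \<bullet> x t\<bar> \<le> 20 / 19 * ?K" by simp
      qed
      finally show "(logistic_deriv (y t) (\<theta> t \<bullet> x t))\<^sup>2 \<le> 20 / 19 * ?K * \<alpha> t"
        using near[of t] t by (simp add: logistic_weight_eq)
    qed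
    also have "\<dots> = 20 / 19 * ?K * (\<Sum>t = Suc T..n. \<alpha> t * ?q t)" by (simp add: sum_distrib_left mult.assoc)
    \<comment> \<open>Here 20/19 is relaxed to 3, and the number \<open>n - T\<close> of
      observations to \<open>n\<close>.\<close>
    also have "\<dots> \<le> 3 * ?K * (CARD('n) * ln (1 + real n * (lambda_max P1 * D\<^sup>2 / (4 * real CARD('n)))))"
    proof (intro mult_mono)
      have "(\<Sum>t = Suc T..n. \<alpha> t * ?q t) \<le> CARD('n) * ln (1 + real (Suc n - Suc T) * (lambda_max P1 * D\<^sup>2 / (4 * real CARD('n))))"
        using T near logistic_weight_le by (intro sum_weighted_form_le) auto
      also have "\<dots> \<le> CARD('n) * ln (1 + real n * (lambda_max P1 * D\<^sup>2 / (4 * real CARD('n))))"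
        using lambda_max_P1_pos
        by (intro mult_left_mono ln_mono add_left_mono mult_right_mono add_pos_nonneg mult_nonneg_nonneg) auto
      finally show "(\<Sum>t = Suc T..n. \<alpha> t * ?q t) \<le> CARD('n) * ln (1 + real n * (lambda_max P1 * D\<^sup>2 / (4 * real CARD('n))))" .
      show "0 \<le> (\<Sum>t = Suc T..n. \<alpha> t * ?q t)"
        using q by (intro sum_nonneg mult_nonneg_nonneg less_imp_le[OF alpha_pos]) auto
    qed auto
    finally show ?thesis by (simp add: mult_ac)
  qed
  finally show ?thesis by linarith
qed

text \<open>The outcome of the probabilistic argument enters as the hypothesis \<open>ville\<close>,
  which leaves a purely deterministic combination of the burn-in, the energy bound and the
  deviation.\<close>

lemma regret_le:
  fixes L :: "real^'n \<Rightarrow> real"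
  assumes D: "D > 0" and lip: "\<And>\<theta>'. L \<theta>' - L \<theta>star \<le> D * norm (\<theta>' - \<theta>star)"
    and near: "\<And>t. t > T \<Longrightarrow> norm (\<theta> t - \<theta>star) \<le> 1 / (20 * D) \<and> \<alpha> t = logistic_weight (\<theta> t) (x t)"
    and \<delta>: "0 < \<delta>" "\<delta> < 1"
    and ville: "T \<le> n \<Longrightarrow> (\<Sum>t = Suc T..n. (1 / (64 * exp (D * norm \<theta>star))) * (L (\<theta> t) - L \<theta>star
      - (2 * (logistic_deriv (y t) (\<theta> t \<bullet> x t) * ((\<theta> t - \<theta>star) \<bullet> x t))
         - logistic_weight (\<theta> t) (x t) * ((\<theta> t - \<theta>star) \<bullet> x t)\<^sup>2))) \<le> ln (1 / \<delta>)"
  shows "(\<Sum>t = 1..n. L (\<theta> t) - L \<theta>star)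
    \<le> 3 * real CARD('n) * exp (D * norm \<theta>star)
          * ln (1 + real n * (lambda_max P1 * D\<^sup>2 / (4 * real CARD('n))))
      + lambda_max (matrix_inv P1) / (75 * D\<^sup>2)
      + 64 * exp (D * norm \<theta>star) * ln (inverse \<delta>)
      + real T * (1 / 300 + D * norm (\<theta>1 - \<theta>star))
      + (real T)\<^sup>2 * (lambda_max P1 * D\<^sup>2 / 2)"
proof -
  let ?K = "exp (D * norm \<theta>star)" and ?\<Lambda> = "lambda_max (matrix_inv P1)"
  let ?A = "3 * real CARD('n) * ?K * ln (1 + real n * (lambda_max P1 * D\<^sup>2 / (4 * real CARD('n))))"
  let ?B = "64 * ?K * ln (inverse \<delta>)"
  have \<Lambda>: "?\<Lambda> > 0" by (intro lambda_max_pos pos_def_matrix_inv P1)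
  have A: "?A \<ge> 0" using lambda_max_P1_pos by (intro mult_nonneg_nonneg ln_ge_zero) auto
  have B: "?B \<ge> 0" using \<delta> by (intro mult_nonneg_nonneg ln_ge_zero) (auto simp: one_le_inverse)
  have C: "?\<Lambda> / (75 * D\<^sup>2) \<ge> 0" using \<Lambda> by simp
  have T0: "real T / 300 \<ge> 0" by simp
  have eqT: "real T * (1 / 300 + D * norm (\<theta>1 - \<theta>star)) = real T / 300 + real T * (D * norm (\<theta>1 - \<theta>star))"
    by (simp add: distrib_left)
  show ?thesis
  proof (cases "T \<le> n")
    \<comment> \<open>The horizon ends inside the burn-in. The other terms of the bound are
      nonnegative and can be added; for the logarithm of \<open>inverse \<delta>\<close> this uses
      \<delta> < 1.\<close>
    case False
    then show ?thesis using burn_in_sum_le[OF lip, of n T] A B C T0 unfolding eqT by linarith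
  next
    case True
    define f where "f t = 2 * (logistic_deriv (y t) (\<theta> t \<bullet> x t) * ((\<theta> t - \<theta>star) \<bullet> x t))
         - logistic_weight (\<theta> t) (x t) * ((\<theta> t - \<theta>star) \<bullet> x t)\<^sup>2" for t
    have "(1 / (64 * ?K)) * ((\<Sum>t = Suc T..n. L (\<theta> t) - L \<theta>star) - (\<Sum>t = Suc T..n. f t)) \<le> ln (1 / \<delta>)"
      using ville[OF True] unfolding f_def[symmetric] sum_distrib_left[symmetric] sum_subtractf .
    then have "(\<Sum>t = Suc T..n. L (\<theta> t) - L \<theta>star) - (\<Sum>t = Suc T..n. f t) \<le> ?B"
      by (simp add: field_simps inverse_eq_divide)
    moreover have "(\<Sum>t = Suc T..n. f t) \<le> ?A + ?\<Lambda> / (75 * D\<^sup>2) + real T / 300"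
      unfolding f_def by (rule converged_sum_le) (use D True near in auto)
    moreover have "(\<Sum>t = 1..n. L (\<theta> t) - L \<theta>star)
      = (\<Sum>t = 1..T. L (\<theta> t) - L \<theta>star) + (\<Sum>t = Suc T..n. L (\<theta> t) - L \<theta>star)"
    proof -
      have "{1..n} = {1..T} \<union> {Suc T..n}" "{1..T} \<inter> {Suc T..n} = {}" using True by auto
      then show ?thesis by (simp add: sum.union_disjoint)
    qed
    ultimately show ?thesis using burn_in_sum_le[OF lip, of T T] unfolding eqT by linarith
  qed
qed

end

section \<open>The risk near its minimizer\<close>

locale logistic_model = prob_space M for M :: "'w measure" +
  fixes X :: "'w \<Rightarrow> real^'n" and y :: "'w \<Rightarrow> real" and D :: real and \<theta>star :: "real^'n"
  assumes X [measurable]: "X \<in> borel_measurable M" and y [measurable]: "y \<in> borel_measurable M"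
    and X_le: "\<And>\<omega>. \<omega> \<in> space M \<Longrightarrow> norm (X \<omega>) \<le> D" and y_range: "\<And>\<omega>. \<omega> \<in> space M \<Longrightarrow> y \<omega> \<in> {-1, 1}"
    and D_pos: "D > 0"
    and minimal: "\<And>\<theta>. logistic_risk M X y \<theta>star \<le> logistic_risk M X y \<theta>"
begin

abbreviation L :: "real^'n \<Rightarrow> real" where "L \<equiv> logistic_risk M X y"

section \<open>Integrability, Lipschitz risk and the score\<close>

lemma integrable_bounded:
  fixes f :: "'w \<Rightarrow> real"
  assumes "f \<in> borel_measurable M" "\<And>\<omega>. \<omega> \<in> space M \<Longrightarrow> \<bar>f \<omega>\<bar> \<le> B"
  shows "integrable M f"
  using assms by (intro integrable_const_bound[of _ B]) auto

lemma inner_X_le: "\<omega> \<in> space M \<Longrightarrow> \<bar>v \<bullet> X \<omega>\<bar> \<le> D * norm v"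
  using Cauchy_Schwarz_ineq2[of v "X \<omega>"] X_le[of \<omega>]
  by (metis mult.commute mult_left_mono norm_ge_zero order_trans)

lemma measurable_loss [measurable]: "(\<lambda>\<omega>. logistic_loss (y \<omega>) (\<theta> \<bullet> X \<omega>)) \<in> borel_measurable M"
  unfolding logistic_loss_def by measurable

lemma measurable_deriv [measurable]: "(\<lambda>\<omega>. logistic_deriv (y \<omega>) (\<theta> \<bullet> X \<omega>)) \<in> borel_measurable M"
  unfolding logistic_deriv_def by measurable

lemma measurable_var [measurable]: "(\<lambda>\<omega>. logistic_var (\<theta> \<bullet> X \<omega>)) \<in> borel_measurable M"
  unfolding logistic_var_def by measurable

lemma integrable_loss: "integrable M (\<lambda>\<omega>. logistic_loss (y \<omega>) (\<theta> \<bullet> X \<omega>))"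
proof (rule integrable_bounded)
  fix \<omega> assume w: "\<omega> \<in> space M"
  have "\<bar>logistic_loss (y \<omega>) (\<theta> \<bullet> X \<omega>) - logistic_loss (y \<omega>) 0\<bar> \<le> D * norm \<theta>"
    using logistic_loss_lipschitz[OF y_range[OF w], of "\<theta> \<bullet> X \<omega>" 0] inner_X_le[OF w, of \<theta>] by simp
  moreover have "logistic_loss (y \<omega>) 0 = ln 2" by (simp add: logistic_loss_def)
  ultimately show "\<bar>logistic_loss (y \<omega>) (\<theta> \<bullet> X \<omega>)\<bar> \<le> D * norm \<theta> + ln 2"
    using ln_ge_zero[of 2] by linarith
qed measurable

lemma risk_lipschitz: "\<bar>L \<theta> - L \<theta>'\<bar> \<le> D * norm (\<theta> - \<theta>')"
proof -
  have "L \<theta> - L \<theta>' = (LINT \<omega>|M. logistic_loss (y \<omega>) (\<theta> \<bullet> X \<omega>) - logistic_loss (y \<omega>) (\<theta>' \<bullet> X \<omega>))"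
    unfolding logistic_risk_def using integrable_loss by simp
  also have "\<bar>\<dots>\<bar> \<le> (LINT \<omega>|M. \<bar>logistic_loss (y \<omega>) (\<theta> \<bullet> X \<omega>) - logistic_loss (y \<omega>) (\<theta>' \<bullet> X \<omega>)\<bar>)"
    by (rule integral_abs_bound)
  also have "\<dots> \<le> (LINT \<omega>|M. D * norm (\<theta> - \<theta>'))"
  proof (intro integral_mono integrable_abs Bochner_Integration.integrable_diff integrable_loss)
    fix \<omega> assume w: "\<omega> \<in> space M"
    show "\<bar>logistic_loss (y \<omega>) (\<theta> \<bullet> X \<omega>) - logistic_loss (y \<omega>) (\<theta>' \<bullet> X \<omega>)\<bar> \<le> D * norm (\<theta> - \<theta>')"
      using logistic_loss_lipschitz[OF y_range[OF w], of "\<theta> \<bullet> X \<omega>" "\<theta>' \<bullet> X \<omega>"] inner_X_le[OF w, of "\<theta> - \<theta>'"]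
      by (simp add: inner_diff_left)
  qed auto
  also have "\<dots> = D * norm (\<theta> - \<theta>')" by (simp add: prob_space)
  finally show ?thesis .
qed

lemma borel_measurable_risk [measurable]: "L \<in> borel_measurable borel"
proof (rule borel_measurable_continuous_onI)
  have "D-lipschitz_on UNIV L"
    by (rule lipschitz_onI) (use risk_lipschitz D_pos in \<open>auto simp: dist_norm\<close>)
  then show "continuous_on UNIV L" by (rule lipschitz_on_continuous_on)
qed

lemma integrable_score: "integrable M (\<lambda>\<omega>. logistic_deriv (y \<omega>) (\<theta> \<bullet> X \<omega>) * (v \<bullet> X \<omega>))"
proof (rule integrable_bounded)
  fix \<omega> assume w: "\<omega> \<in> space M"
  have "\<bar>logistic_deriv (y \<omega>) (\<theta> \<bullet> X \<omega>)\<bar> * \<bar>v \<bullet> X \<omega>\<bar> \<le> 1 * (D * norm v)"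
    by (intro mult_mono abs_logistic_deriv_le y_range[OF w] inner_X_le[OF w]) auto
  then show "\<bar>logistic_deriv (y \<omega>) (\<theta> \<bullet> X \<omega>) * (v \<bullet> X \<omega>)\<bar> \<le> D * norm v" by (simp add: abs_mult)
qed measurable

text \<open>Comparing with the quadratic upper bound of the loss avoids differentiating under the integral.\<close>

lemma score_at_minimizer: "(LINT \<omega>|M. logistic_deriv (y \<omega>) (\<theta>star \<bullet> X \<omega>) * (v \<bullet> X \<omega>)) = 0"
proof -
  define G where "G v = (LINT \<omega>|M. logistic_deriv (y \<omega>) (\<theta>star \<bullet> X \<omega>) * (v \<bullet> X \<omega>))" for v
  have nn: "G v \<ge> 0" for v
  proof (rule ccontr)
    assume neg: "\<not> G v \<ge> 0"
    define c where "c = (D * norm v)\<^sup>2 / 8"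
    have c: "c \<ge> 0" by (simp add: c_def)
    \<comment> \<open>A step this short lets the negative slope beat the quadratic term:
      \<open>G v + s * c\<close> equals \<open>G v / (c + 1)\<close>. The added 1 keeps the
      denominator positive without asking whether \<open>c\<close> vanishes.\<close>
    define s where "s = - G v / (c + 1)"
    have s: "s > 0" using neg c unfolding s_def by (intro divide_pos_pos) auto
    have "L (\<theta>star + s *\<^sub>R v) \<le> (LINT \<omega>|M. logistic_loss (y \<omega>) (\<theta>star \<bullet> X \<omega>)
        + s * (logistic_deriv (y \<omega>) (\<theta>star \<bullet> X \<omega>) * (v \<bullet> X \<omega>)) + s\<^sup>2 * c)"
      unfolding logistic_risk_def
    proof (intro integral_mono integrable_loss Bochner_Integration.integrable_add
        integrable_mult_right integrable_score)
      fix \<omega> assume w: "\<omega> \<in> space M"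
      have "(v \<bullet> X \<omega>)\<^sup>2 \<le> (D * norm v)\<^sup>2" using inner_X_le[OF w, of v] by (metis abs_ge_zero power2_abs power_mono)
      then have "s\<^sup>2 * (v \<bullet> X \<omega>)\<^sup>2 / 8 \<le> s\<^sup>2 * c" by (simp add: c_def mult_left_mono)
      then show "logistic_loss (y \<omega>) ((\<theta>star + s *\<^sub>R v) \<bullet> X \<omega>) \<le> logistic_loss (y \<omega>) (\<theta>star \<bullet> X \<omega>)
        + s * (logistic_deriv (y \<omega>) (\<theta>star \<bullet> X \<omega>) * (v \<bullet> X \<omega>)) + s\<^sup>2 * c"
        using logistic_loss_quadratic_upper[OF y_range[OF w], of "(\<theta>star + s *\<^sub>R v) \<bullet> X \<omega>" "\<theta>star \<bullet> X \<omega>"]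
        by (simp add: inner_add_left power_mult_distrib algebra_simps)
    qed auto
    also have "\<dots> = L \<theta>star + s * G v + s\<^sup>2 * c"
      by (simp add: integrable_loss integrable_score logistic_risk_def G_def prob_space)
    finally have "0 \<le> s * (G v + s * c)"
      using minimal[of "\<theta>star + s *\<^sub>R v"] by (simp add: algebra_simps power2_eq_square)
    then have "0 \<le> G v + s * c" using s by (simp add: zero_le_mult_iff)
    also have "\<dots> = G v / (c + 1)" using c by (simp add: s_def field_simps)
    finally show False using neg c by (simp add: zero_le_divide_iff)
  qed
  have "G (- v) = - G v" by (simp add: G_def)
  with nn[of v] nn[of "- v"] show ?thesis by (simp add: G_def)
qed

text \<open>The mean of the bracket is at most \<open>- 3/10 * Q\<close>, where \<open>Q\<close> is the expected curvature
  along \<open>\<theta> - \<theta>star\<close>, and its second moment is at most of order \<open>exp (D * norm \<theta>star) * Q\<close>;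
  the factor \<open>1 / (64 * exp (D * norm \<theta>star))\<close> lets the mean win.\<close>

lemma exp_moment_le_1:
  assumes near: "norm (\<theta> - \<theta>star) \<le> 1 / (20 * D)"
  shows "(\<integral>\<^sup>+\<omega>. ennreal (exp ((1 / (64 * exp (D * norm \<theta>star))) * (L \<theta> - L \<theta>star
      - (2 * (logistic_deriv (y \<omega>) (\<theta> \<bullet> X \<omega>) * ((\<theta> - \<theta>star) \<bullet> X \<omega>))
         - logistic_weight \<theta> (X \<omega>) * ((\<theta> - \<theta>star) \<bullet> X \<omega>)\<^sup>2)))) \<partial>M) \<le> 1"
proof -
  define K where "K = exp (D * norm \<theta>star)"
  define c where "c = 1 / (64 * K)"
  define m where "m = L \<theta> - L \<theta>star"
  define u where "u \<omega> = (\<theta> - \<theta>star) \<bullet> X \<omega>" for \<omega>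
  define w where "w \<omega> = logistic_var (\<theta> \<bullet> X \<omega>)" for \<omega>
  define d where "d \<omega> = logistic_deriv (y \<omega>) (\<theta> \<bullet> X \<omega>)" for \<omega>
  define dl where "dl \<omega> = logistic_loss (y \<omega>) (\<theta> \<bullet> X \<omega>) - logistic_loss (y \<omega>) (\<theta>star \<bullet> X \<omega>)" for \<omega>
  define g where "g \<omega> = logistic_deriv (y \<omega>) (\<theta>star \<bullet> X \<omega>) * u \<omega>" for \<omega>
  define Q where "Q = (LINT \<omega>|M. w \<omega> * (u \<omega>)\<^sup>2)"
  have K: "K \<ge> 1" using D_pos by (simp add: K_def)
  have c: "0 < c" "c \<le> 1 / 64" "c * K = 1 / 64" using K by (auto simp: c_def divide_simps)
  have Dn: "D * norm (\<theta> - \<theta>star) \<le> 1 / 20"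
    using mult_left_mono[OF near, of D] D_pos by simp
  have u: "\<bar>u \<omega>\<bar> \<le> 1 / 20" if "\<omega> \<in> space M" for \<omega>
    using inner_X_le[OF that, of "\<theta> - \<theta>star"] Dn by (simp add: u_def)
  have u2: "(u \<omega>)\<^sup>2 \<le> 1 / 400" if "\<omega> \<in> space M" for \<omega>
    using power_mono[OF u[OF that], of 2] by (simp add: power_divide)
  have w: "0 < w \<omega>" "w \<omega> \<le> 1 / 4" for \<omega>
    unfolding w_def by (rule logistic_var_pos, rule logistic_var_le)
  have wu: "0 \<le> w \<omega> * (u \<omega>)\<^sup>2" for \<omega> using w(1)[of \<omega>] by simp
  have wu2: "w \<omega> * (u \<omega>)\<^sup>2 \<le> 1 / 1600" if "\<omega> \<in> space M" for \<omega>
    using mult_mono[OF w(2)[of \<omega>] u2[OF that]] by simp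
  have [measurable]: "u \<in> borel_measurable M" "w \<in> borel_measurable M" "d \<in> borel_measurable M"
    "dl \<in> borel_measurable M" "g \<in> borel_measurable M"
    unfolding u_def[abs_def] w_def[abs_def] d_def[abs_def] dl_def[abs_def] g_def[abs_def] by measurable
  have int_wu: "integrable M (\<lambda>\<omega>. w \<omega> * (u \<omega>)\<^sup>2)"
    using wu wu2 by (intro integrable_bounded[of _ "1 / 1600"]) auto
  have int_dl: "integrable M dl" unfolding dl_def[abs_def] by (intro Bochner_Integration.integrable_diff integrable_loss)
  have int_g: "integrable M g" unfolding g_def[abs_def] u_def[abs_def] by (rule integrable_score)
  have E_g: "(LINT \<omega>|M. g \<omega>) = 0" unfolding g_def u_def by (rule score_at_minimizer)
  have E_dl: "(LINT \<omega>|M. dl \<omega>) = m" unfolding dl_def m_def logistic_risk_def using integrable_loss by simp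
  have uz: "\<theta> \<bullet> X \<omega> - \<theta>star \<bullet> X \<omega> = u \<omega>" for \<omega> by (simp add: u_def inner_diff_left)
  have Q: "Q \<ge> 0" unfolding Q_def using wu by simp
  have m0: "0 \<le> m" using minimal by (simp add: m_def)
  have m1: "m \<le> 1 / 20" using risk_lipschitz[of \<theta> \<theta>star] Dn by (simp add: m_def)
  have "m \<le> (LINT \<omega>|M. g \<omega> + 53 / 100 * (w \<omega> * (u \<omega>)\<^sup>2))"
    unfolding E_dl[symmetric]
  proof (intro integral_mono int_dl Bochner_Integration.integrable_add integrable_mult_right int_g int_wu)
    fix \<omega> assume \<omega>: "\<omega> \<in> space M"
    show "dl \<omega> \<le> g \<omega> + 53 / 100 * (w \<omega> * (u \<omega>)\<^sup>2)"
      using logistic_loss_local_upper[OF y_range[OF \<omega>], of "\<theta> \<bullet> X \<omega>" "\<theta>star \<bullet> X \<omega>"] u[OF \<omega>]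
      unfolding uz dl_def g_def w_def by simp
  qed
  also have "\<dots> = 53 / 100 * Q" using int_g int_wu E_g by (simp add: Q_def)
  finally have mQ: "m \<le> 53 / 100 * Q" .
  define Z where "Z \<omega> = c * (m - (2 * (d \<omega> * u \<omega>) - w \<omega> * (u \<omega>)\<^sup>2))" for \<omega>
  \<comment> \<open>A majorant of \<open>1 + Z + Z\<^sup>2\<close> whose expectation can be computed
    from those of \<open>dl\<close>, \<open>g\<close> and the curvature term. The factor 3 comes
    from the square of a sum of three terms.\<close>
  define B where "B \<omega> = 1 + c * (m - dl \<omega> - g \<omega> - 3 / 10 * (w \<omega> * (u \<omega>)\<^sup>2))
    + 3 * c\<^sup>2 * (m\<^sup>2 + 17 / 4 * K * (w \<omega> * (u \<omega>)\<^sup>2))" for \<omega>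
  have le: "exp (Z \<omega>) \<le> B \<omega>" if \<omega>: "\<omega> \<in> space M" for \<omega>
  proof -
    let ?a = "2 * (d \<omega> * u \<omega>)" and ?b = "w \<omega> * (u \<omega>)\<^sup>2"
    have "\<bar>d \<omega>\<bar> \<le> 1" unfolding d_def by (intro abs_logistic_deriv_le y_range \<omega>)
    then have "\<bar>d \<omega> * u \<omega>\<bar> \<le> 1 * (1 / 20)" unfolding abs_mult using u[OF \<omega>] by (intro mult_mono) auto
    then have "\<bar>m - (?a - ?b)\<bar> \<le> 1" using m0 m1 wu[of \<omega>] wu2[OF \<omega>] by linarith
    then have "c * \<bar>m - (?a - ?b)\<bar> \<le> 1 * 1" using c by (intro mult_mono) auto
    then have Z1: "\<bar>Z \<omega>\<bar> \<le> 1" using c by (simp add: Z_def abs_mult)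
    have "(d \<omega>)\<^sup>2 \<le> exp \<bar>\<theta> \<bullet> X \<omega>\<bar> * w \<omega>" unfolding d_def w_def by (intro logistic_deriv_sq_le y_range \<omega>)
    also have "exp \<bar>\<theta> \<bullet> X \<omega>\<bar> \<le> K * (20 / 19)"
    proof -
      have "\<bar>\<theta> \<bullet> X \<omega>\<bar> \<le> D * norm \<theta>star + 1 / 20"
        using u[OF \<omega>] uz[of \<omega>] inner_X_le[OF \<omega>, of \<theta>star] by linarith
      then have "exp \<bar>\<theta> \<bullet> X \<omega>\<bar> \<le> K * exp (1 / 20)" by (simp add: K_def exp_add[symmetric])
      also have "\<dots> \<le> K * (20 / 19)" using exp_twentieth K by (intro mult_left_mono) auto
      finally show ?thesis .
    qed
    finally have "(d \<omega>)\<^sup>2 \<le> K * (20 / 19) * w \<omega>" using w(1)[of \<omega>] by simp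
    then have "(d \<omega>)\<^sup>2 * (u \<omega>)\<^sup>2 \<le> K * (20 / 19) * w \<omega> * (u \<omega>)\<^sup>2" by (intro mult_right_mono) auto
    then have a2: "?a\<^sup>2 \<le> 80 / 19 * (K * ?b)" by (simp add: power_mult_distrib)
    \<comment> \<open>The coefficients 80/19 for \<open>?a\<^sup>2\<close> and 1/1600 for
      \<open>?b\<^sup>2\<close> add up to less than 17/4.\<close>
    have b2: "?b\<^sup>2 \<le> 1 / 1600 * (K * ?b)"
    proof -
      have "?b * ?b \<le> 1 / 1600 * ?b" using wu[of \<omega>] wu2[OF \<omega>] by (intro mult_right_mono)
      moreover have "1 * ?b \<le> K * ?b" using wu[of \<omega>] K by (intro mult_right_mono)
      ultimately show ?thesis unfolding power2_eq_square by linarith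
    qed
    have Kb: "0 \<le> K * ?b" using K wu[of \<omega>] by simp
    \<comment> \<open>The difference of the two sides is the sum of the three squares supplied
      below.\<close>
    have "(m - (?a - ?b))\<^sup>2 \<le> 3 * (m\<^sup>2 + ?a\<^sup>2 + ?b\<^sup>2)"
      using zero_le_power2[of "m + ?a"] zero_le_power2[of "m - ?b"] zero_le_power2[of "?a + ?b"]
      by (simp only: power2_eq_square) (simp add: algebra_simps)
    also have "\<dots> \<le> 3 * (m\<^sup>2 + 17 / 4 * (K * ?b))" using a2 b2 Kb by (simp add: field_simps)
    finally have "c\<^sup>2 * (m - (?a - ?b))\<^sup>2 \<le> c\<^sup>2 * (3 * (m\<^sup>2 + 17 / 4 * (K * ?b)))" by (intro mult_left_mono) auto
    then have Z2: "(Z \<omega>)\<^sup>2 \<le> 3 * c\<^sup>2 * (m\<^sup>2 + 17 / 4 * K * ?b)" 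
      by (simp only: Z_def power_mult_distrib mult_ac)
    have "m - (?a - ?b) \<le> m - dl \<omega> - g \<omega> - 3 / 10 * ?b"
      using logistic_loss_local_lower[OF y_range[OF \<omega>], of "\<theta> \<bullet> X \<omega>" "\<theta>star \<bullet> X \<omega>"] u[OF \<omega>]
      unfolding uz dl_def g_def w_def d_def by simp
    then have "Z \<omega> \<le> c * (m - dl \<omega> - g \<omega> - 3 / 10 * ?b)" unfolding Z_def using c by (intro mult_left_mono) auto
    with Z2 exp_le_quadratic[OF Z1] show ?thesis unfolding B_def by linarith
  qed
  have int_B: "integrable M B" unfolding B_def[abs_def]
    by (intro Bochner_Integration.integrable_add Bochner_Integration.integrable_diff integrable_mult_right
        int_dl int_g int_wu integrable_const)
  have "(LINT \<omega>|M. B \<omega>) = 1 + c * (- (3 / 10) * Q) + 3 * c\<^sup>2 * (m\<^sup>2 + 17 / 4 * K * Q)"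
    unfolding B_def
    by (simp add: int_dl int_g int_wu E_g E_dl Q_def prob_space)
  also have "\<dots> \<le> 1"
  proof -
    \<comment> \<open>The budget: \<open>m\<^sup>2\<close> is at most \<open>Q / 20\<close>, and 3 *
      (1/20 + 17/4) = 129/10. Multiplied by \<open>c * K = 1 / 64\<close> this is about 0.2, below
      the 3/10 supplied by the mean.\<close>
    have "m\<^sup>2 \<le> 1 / 20 * m" unfolding power2_eq_square using m0 m1 by (intro mult_right_mono)
    then have "m\<^sup>2 \<le> 1 / 20 * Q" using mQ Q by linarith
    also have "\<dots> \<le> 1 / 20 * (K * Q)" using mult_right_mono[OF K Q] by simp
    finally have "3 * c * (m\<^sup>2 + 17 / 4 * K * Q) \<le> 3 * c * (1 / 20 * (K * Q) + 17 / 4 * K * Q)"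
      using c by (intro mult_left_mono) auto
    also have "\<dots> = 129 / 10 * (c * K) * Q" by (simp add: algebra_simps)
    also have "\<dots> \<le> 3 / 10 * Q" using Q by (simp add: c(3))
    finally have "c * (3 * c * (m\<^sup>2 + 17 / 4 * K * Q)) \<le> c * (3 / 10 * Q)" using c by (intro mult_left_mono) auto
    then show ?thesis by (simp add: power2_eq_square mult_ac)
  qed
  finally have EB: "(LINT \<omega>|M. B \<omega>) \<le> 1" .
  have "(\<integral>\<^sup>+\<omega>. ennreal (exp (Z \<omega>)) \<partial>M) \<le> (\<integral>\<^sup>+\<omega>. ennreal (B \<omega>) \<partial>M)"
    by (intro nn_integral_mono ennreal_leI le)
  also have "\<dots> = ennreal (LINT \<omega>|M. B \<omega>)"
  proof (rule nn_integral_eq_integral[OF int_B], rule AE_I2)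
    fix \<omega> assume "\<omega> \<in> space M"
    from le[OF this] show "0 \<le> B \<omega>" by (meson exp_ge_zero order_trans)
  qed
  also have "\<dots> \<le> 1" using EB by (simp add: ennreal_le_1)
  finally show ?thesis
    unfolding Z_def d_def w_def u_def m_def c_def K_def logistic_weight_eq .
qed

end

section \<open>Ville's inequality\<close>

context prob_space
begin

text \<open>A state driven by independent inputs is independent of the next input.\<close>

lemma nn_integral_state_input:
  fixes \<xi> :: "nat \<Rightarrow> 'a \<Rightarrow> 'b" and \<sigma> :: "nat \<Rightarrow> 'a \<Rightarrow> 's"
  assumes indep: "indep_vars (\<lambda>_. N) \<xi> {1..}"
    and F: "\<And>t. F t \<in> S \<Otimes>\<^sub>M N \<rightarrow>\<^sub>M S" and s0: "s0 \<in> space S"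
    and \<sigma>_1: "\<And>\<omega>. \<omega> \<in> space M \<Longrightarrow> \<sigma> 1 \<omega> = s0"
    and \<sigma>_Suc: "\<And>t \<omega>. t \<ge> 1 \<Longrightarrow> \<omega> \<in> space M \<Longrightarrow> \<sigma> (Suc t) \<omega> = F t (\<sigma> t \<omega>, \<xi> t \<omega>)"
    and f: "f \<in> borel_measurable (S \<Otimes>\<^sub>M N)" and t: "t \<ge> 1"
  shows "\<sigma> t \<in> M \<rightarrow>\<^sub>M S"
    and "(\<integral>\<^sup>+\<omega>. f (\<sigma> t \<omega>, \<xi> t \<omega>) \<partial>M) = (\<integral>\<^sup>+\<omega>. (\<integral>\<^sup>+x. f (\<sigma> t \<omega>, x) \<partial>distr M N (\<xi> t)) \<partial>M)"
proof -
  \<comment> \<open>\<open>H k\<close> is the state at time \<open>Suc k\<close> as a function of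
    the inputs 1 to \<open>k\<close> alone. Writing the state through the inputs lets their
    independence pass to it.\<close>
  define H where "H = rec_nat (\<lambda>_. s0) (\<lambda>k G x. F (Suc k) (G x, x (Suc k)))"
  have H_0: "H 0 = (\<lambda>_. s0)" and H_Suc: "H (Suc k) = (\<lambda>x. F (Suc k) (H k x, x (Suc k)))" for k
    by (simp_all add: H_def)
  have H_meas: "H k \<in> PiM A (\<lambda>_. N) \<rightarrow>\<^sub>M S" if "{1..k} \<subseteq> A" for k and A :: "nat set"
    using that
  proof (induction k)
    case 0
    show ?case by (simp add: H_0 s0)
  next
    case (Suc k)
    have 1: "H k \<in> PiM A (\<lambda>_. N) \<rightarrow>\<^sub>M S" using Suc by (intro Suc.IH) auto
    have 2: "(\<lambda>x. x (Suc k)) \<in> PiM A (\<lambda>_. N) \<rightarrow>\<^sub>M N"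
      using Suc.prems by (intro measurable_component_singleton) auto
    show ?case unfolding H_Suc by (rule measurable_compose[OF measurable_Pair[OF 1 2] F])
  qed
  obtain k where k: "t = Suc k" using t by (cases t) auto
  define R where "R \<omega> = restrict (\<lambda>i. \<xi> i \<omega>) {1..k}" for \<omega>
  have state: "\<sigma> (Suc j) \<omega> = H j (R \<omega>)" if "\<omega> \<in> space M" "j \<le> k" for j \<omega>
    using that(2)
  proof (induction j)
    case 0
    show ?case using \<sigma>_1[OF that(1)] by (simp add: H_0)
  next
    case (Suc j)
    then show ?case using \<sigma>_Suc[of "Suc j", OF _ that(1)] by (simp add: H_Suc R_def)
  qed
  have \<xi>_meas: "\<xi> t \<in> M \<rightarrow>\<^sub>M N" using indep t by (auto simp: indep_vars_def)
  \<comment> \<open>The next input is wrapped as a one-coordinate product, since independence of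
    disjoint blocks is stated for restrictions of the family.\<close>
  define R' where "R' \<omega> = restrict (\<lambda>i. \<xi> i \<omega>) {t}" for \<omega>
  let ?A = "PiM {1..k} (\<lambda>_. N)" and ?B = "PiM {t} (\<lambda>_. N)"
  have ind: "indep_var ?A R ?B R'"
    unfolding R_def[abs_def] R'_def[abs_def] using k by (intro indep_var_restrict[OF indep]) auto
  have R: "R \<in> M \<rightarrow>\<^sub>M ?A" and R': "R' \<in> M \<rightarrow>\<^sub>M ?B"
    using indep_var_rv1[OF ind] indep_var_rv2[OF ind] .
  have H: "H k \<in> ?A \<rightarrow>\<^sub>M S" by (rule H_meas) simp
  have \<sigma>_eq: "\<sigma> t \<omega> = H k (R \<omega>)" if "\<omega> \<in> space M" for \<omega>
    using state[OF that, of k] k by simp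
  show \<sigma>_meas: "\<sigma> t \<in> M \<rightarrow>\<^sub>M S"
    using measurable_compose[OF R H] \<sigma>_eq by (simp cong: measurable_cong)
  interpret T: prob_space "distr M ?B R'" by (rule prob_space_distr[OF R'])
  define g where "g p = f (H k (fst p), snd p t)" for p
  have comp: "(\<lambda>r. r t) \<in> ?B \<rightarrow>\<^sub>M N" by (rule measurable_component_singleton) simp
  have g: "g \<in> borel_measurable (?A \<Otimes>\<^sub>M ?B)"
    unfolding g_def[abs_def]
    by (rule measurable_compose[OF measurable_Pair f])
      (rule measurable_compose[OF measurable_fst H] measurable_compose[OF measurable_snd comp])+
  have inner: "(\<integral>\<^sup>+r. g (R \<omega>, r) \<partial>distr M ?B R') = (\<integral>\<^sup>+x. f (\<sigma> t \<omega>, x) \<partial>distr M N (\<xi> t))"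
    if "\<omega> \<in> space M" for \<omega>
  proof -
    have "(\<integral>\<^sup>+r. g (R \<omega>, r) \<partial>distr M ?B R') = (\<integral>\<^sup>+\<omega>'. g (R \<omega>, R' \<omega>') \<partial>M)"
      using measurable_compose_Pair1[OF measurable_space[OF R that] g] by (intro nn_integral_distr[OF R']) simp
    also have "\<dots> = (\<integral>\<^sup>+\<omega>'. f (\<sigma> t \<omega>, \<xi> t \<omega>') \<partial>M)"
      by (simp add: g_def R'_def \<sigma>_eq[OF that])
    also have "\<dots> = (\<integral>\<^sup>+x. f (\<sigma> t \<omega>, x) \<partial>distr M N (\<xi> t))"
      using measurable_compose_Pair1[OF measurable_space[OF \<sigma>_meas that] f]
      by (intro nn_integral_distr[OF \<xi>_meas, symmetric]) simp
    finally show ?thesis .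
  qed
  have "(\<integral>\<^sup>+\<omega>. f (\<sigma> t \<omega>, \<xi> t \<omega>) \<partial>M) = (\<integral>\<^sup>+\<omega>. g (R \<omega>, R' \<omega>) \<partial>M)"
    by (intro nn_integral_cong) (simp add: \<sigma>_eq g_def R'_def)
  also have "\<dots> = (\<integral>\<^sup>+p. g p \<partial>distr M (?A \<Otimes>\<^sub>M ?B) (\<lambda>\<omega>. (R \<omega>, R' \<omega>)))"
    using g by (intro nn_integral_distr[OF measurable_Pair[OF R R'], symmetric]) simp
  also have "\<dots> = (\<integral>\<^sup>+p. g p \<partial>(distr M ?A R \<Otimes>\<^sub>M distr M ?B R'))"
    using ind unfolding indep_var_distribution_eq by simp
  also have "\<dots> = (\<integral>\<^sup>+s. (\<integral>\<^sup>+r. g (s, r) \<partial>distr M ?B R') \<partial>distr M ?A R)"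
    by (rule T.nn_integral_fst[symmetric]) (use g in simp)
  also have "\<dots> = (\<integral>\<^sup>+\<omega>. (\<integral>\<^sup>+r. g (R \<omega>, r) \<partial>distr M ?B R') \<partial>M)"
    by (intro nn_integral_distr[OF R] T.borel_measurable_nn_integral_fst) (use g in simp)
  also have "\<dots> = (\<integral>\<^sup>+\<omega>. (\<integral>\<^sup>+x. f (\<sigma> t \<omega>, x) \<partial>distr M N (\<xi> t)) \<partial>M)"
    by (intro nn_integral_cong inner)
  finally show "(\<integral>\<^sup>+\<omega>. f (\<sigma> t \<omega>, \<xi> t \<omega>) \<partial>M) = (\<integral>\<^sup>+\<omega>. (\<integral>\<^sup>+x. f (\<sigma> t \<omega>, x) \<partial>distr M N (\<xi> t)) \<partial>M)" .
qed

text \<open>In the proof \<open>V\<close> is the product process stopped when it first exceeds \<open>1 / \<delta>\<close>.\<close>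

lemma ville_state_machine:
  fixes \<xi> :: "nat \<Rightarrow> 'a \<Rightarrow> 'b" and \<sigma> :: "nat \<Rightarrow> 'a \<Rightarrow> 's" and h :: "nat \<Rightarrow> 's \<times> 'b \<Rightarrow> ennreal"
  assumes indep: "indep_vars (\<lambda>_. N) \<xi> {1..}"
    and F [measurable]: "\<And>t. F t \<in> S \<Otimes>\<^sub>M N \<rightarrow>\<^sub>M S" and s0: "s0 \<in> space S"
    and \<sigma>_1: "\<And>\<omega>. \<omega> \<in> space M \<Longrightarrow> \<sigma> 1 \<omega> = s0"
    and \<sigma>_Suc: "\<And>t \<omega>. t \<ge> 1 \<Longrightarrow> \<omega> \<in> space M \<Longrightarrow> \<sigma> (Suc t) \<omega> = F t (\<sigma> t \<omega>, \<xi> t \<omega>)"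
    and h [measurable]: "\<And>t. h t \<in> borel_measurable (S \<Otimes>\<^sub>M N)"
    and h_le: "\<And>t s. t \<ge> 1 \<Longrightarrow> s \<in> space S \<Longrightarrow> (\<integral>\<^sup>+x. h t (s, x) \<partial>distr M N (\<xi> t)) \<le> 1"
    and \<delta>: "\<delta> > 0"
  shows "prob {\<omega> \<in> space M. \<forall>n. (\<Prod>t = 1..n. h t (\<sigma> t \<omega>, \<xi> t \<omega>)) \<le> ennreal (1 / \<delta>)} \<ge> 1 - \<delta>"
    (is "prob ?G \<ge> _")
proof -
  define c where "c = ennreal (1 / \<delta>)"
  define V where "V = rec_nat (\<lambda>_. 1) (\<lambda>k U \<omega>. if U \<omega> > c then U \<omega> else U \<omega> * h (Suc k) (\<sigma> (Suc k) \<omega>, \<xi> (Suc k) \<omega>))"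
  have V_0: "V 0 \<omega> = 1"
    and V_Suc: "V (Suc k) \<omega> = (if V k \<omega> > c then V k \<omega> else V k \<omega> * h (Suc k) (\<sigma> (Suc k) \<omega>, \<xi> (Suc k) \<omega>))"
    for k \<omega> by (simp_all add: V_def)
  \<comment> \<open>Joining the stopped product to the state gives another recursion driven by the
    same inputs, so the integration formula above applies to both at once.\<close>
  define F' where "F' t p = (F t (fst (fst p), snd p),
      if snd (fst p) > c then snd (fst p) else snd (fst p) * h t (fst (fst p), snd p))" for t p
  have F' [measurable]: "F' t \<in> (S \<Otimes>\<^sub>M borel) \<Otimes>\<^sub>M N \<rightarrow>\<^sub>M S \<Otimes>\<^sub>M borel" for t
    unfolding F'_def[abs_def] by measurable
  \<comment> \<open>The product lags by one: the state at time \<open>t\<close> has not yet seen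
    input \<open>t\<close>, which is the next factor of \<open>V\<close>.\<close>
  define \<sigma>' where "\<sigma>' t \<omega> = (\<sigma> t \<omega>, V (t - 1) \<omega>)" for t \<omega>
  have s0': "(s0, 1) \<in> space (S \<Otimes>\<^sub>M borel)" using s0 by (simp add: space_pair_measure)
  have \<sigma>'_1: "\<sigma>' 1 \<omega> = (s0, 1)" if "\<omega> \<in> space M" for \<omega>
    using \<sigma>_1[OF that] by (simp add: \<sigma>'_def V_0)
  have \<sigma>'_Suc: "\<sigma>' (Suc t) \<omega> = F' t (\<sigma>' t \<omega>, \<xi> t \<omega>)" if "t \<ge> 1" "\<omega> \<in> space M" for t \<omega>
    using \<sigma>_Suc[OF that] that V_Suc[of "t - 1" \<omega>] by (simp add: \<sigma>'_def F'_def)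
  note aux = nn_integral_state_input[OF indep F' s0' \<sigma>'_1 \<sigma>'_Suc]
  have \<sigma>'_meas: "\<sigma>' t \<in> M \<rightarrow>\<^sub>M S \<Otimes>\<^sub>M borel" if "t \<ge> 1" for t
    by (rule aux(1)[of "\<lambda>_. 0"]) (use that in auto)
  have \<xi>_meas: "\<xi> t \<in> M \<rightarrow>\<^sub>M N" if "t \<ge> 1" for t using indep that by (auto simp: indep_vars_def)
  have \<sigma>_meas: "\<sigma> t \<in> M \<rightarrow>\<^sub>M S" if "t \<ge> 1" for t
    using measurable_compose[OF \<sigma>'_meas[OF that] measurable_fst] by (simp add: \<sigma>'_def)
  have V_meas [measurable]: "V n \<in> borel_measurable M" for n
    using measurable_compose[OF \<sigma>'_meas[of "Suc n"] measurable_snd] by (simp add: \<sigma>'_def)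
  have V_int: "(\<integral>\<^sup>+\<omega>. V n \<omega> \<partial>M) \<le> 1" for n
  proof (induction n)
    case 0
    show ?case by (simp add: V_0 emeasure_space_1)
  next
    case (Suc n)
    define f where "f p = (if snd (fst p) > c then snd (fst p)
      else snd (fst p) * h (Suc n) (fst (fst p), snd p))" for p
    have f: "f \<in> borel_measurable ((S \<Otimes>\<^sub>M borel) \<Otimes>\<^sub>M N)" unfolding f_def[abs_def] by measurable
    have "(\<integral>\<^sup>+\<omega>. V (Suc n) \<omega> \<partial>M) = (\<integral>\<^sup>+\<omega>. f (\<sigma>' (Suc n) \<omega>, \<xi> (Suc n) \<omega>) \<partial>M)"
      by (intro nn_integral_cong) (auto simp: f_def \<sigma>'_def V_Suc)
    also have "\<dots> = (\<integral>\<^sup>+\<omega>. (\<integral>\<^sup>+x. f (\<sigma>' (Suc n) \<omega>, x) \<partial>distr M N (\<xi> (Suc n))) \<partial>M)"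
      by (rule aux(2)) (use f in auto)
    also have "\<dots> \<le> (\<integral>\<^sup>+\<omega>. V n \<omega> \<partial>M)"
    proof (rule nn_integral_mono)
      fix \<omega> assume \<omega>: "\<omega> \<in> space M"
      interpret T: prob_space "distr M N (\<xi> (Suc n))" by (rule prob_space_distr[OF \<xi>_meas]) simp
      have s: "\<sigma> (Suc n) \<omega> \<in> space S" using measurable_space[OF \<sigma>_meas \<omega>] by simp
      then have [measurable]: "(\<lambda>x. h (Suc n) (\<sigma> (Suc n) \<omega>, x)) \<in> borel_measurable N" by measurable
      show "(\<integral>\<^sup>+x. f (\<sigma>' (Suc n) \<omega>, x) \<partial>distr M N (\<xi> (Suc n))) \<le> V n \<omega>"
      proof (cases "V n \<omega> > c")
        case True
        then show ?thesis by (simp add: f_def \<sigma>'_def T.emeasure_space_1[unfolded space_distr])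
      next
        case False
        then have "(\<integral>\<^sup>+x. f (\<sigma>' (Suc n) \<omega>, x) \<partial>distr M N (\<xi> (Suc n)))
          = V n \<omega> * (\<integral>\<^sup>+x. h (Suc n) (\<sigma> (Suc n) \<omega>, x) \<partial>distr M N (\<xi> (Suc n)))"
          by (simp add: f_def \<sigma>'_def nn_integral_cmult)
        also have "\<dots> \<le> V n \<omega> * 1" using h_le[OF _ s] by (intro mult_left_mono) auto
        finally show ?thesis by simp
      qed
    qed
    finally show ?case using Suc.IH by (rule order_trans)
  qed
  define E where "E n = {\<omega> \<in> space M. V n \<omega> > c}" for n
  have E_sets: "E n \<in> sets M" for n unfolding E_def by measurable
  \<comment> \<open>Freezing \<open>V\<close> above \<open>c\<close> makes the exceedance events
    increase. Markov's inequality at each fixed time therefore bounds their union, with no maximal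
    inequality.\<close>
  have inc: "incseq E" by (rule incseq_SucI) (auto simp: E_def V_Suc)
  have prob_E: "emeasure M (E n) \<le> ennreal \<delta>" for n
  proof -
    have "E n \<subseteq> {\<omega> \<in> space M. 1 \<le> ennreal \<delta> * V n \<omega>}"
    proof
      fix \<omega> assume \<omega>: "\<omega> \<in> E n"
      then have "ennreal \<delta> * c \<le> ennreal \<delta> * V n \<omega>" by (intro mult_left_mono) (auto simp: E_def)
      moreover have "ennreal \<delta> * c = 1" using \<delta> by (simp add: c_def ennreal_mult[symmetric])
      ultimately show "\<omega> \<in> {\<omega> \<in> space M. 1 \<le> ennreal \<delta> * V n \<omega>}" using \<omega> by (auto simp: E_def)
    qed
    then have "emeasure M (E n) \<le> emeasure M {\<omega> \<in> space M. 1 \<le> ennreal \<delta> * V n \<omega>}"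
      by (rule emeasure_mono) measurable
    also have "\<dots> \<le> ennreal \<delta> * (\<integral>\<^sup>+\<omega>. V n \<omega> * indicator (space M) \<omega> \<partial>M)"
      using nn_integral_Markov_inequality[of "V n" "space M" M "ennreal \<delta>"] by simp
    also have "(\<integral>\<^sup>+\<omega>. V n \<omega> * indicator (space M) \<omega> \<partial>M) = (\<integral>\<^sup>+\<omega>. V n \<omega> \<partial>M)"
      by (intro nn_integral_cong) simp
    also have "ennreal \<delta> * \<dots> \<le> ennreal \<delta> * 1" by (intro mult_left_mono V_int) simp
    finally show ?thesis by simp
  qed
  have "emeasure M (\<Union>n. E n) = (SUP n. emeasure M (E n))"
    using E_sets inc by (intro SUP_emeasure_incseq[symmetric]) auto
  also have "\<dots> \<le> ennreal \<delta>" by (intro SUP_least prob_E)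
  finally have "prob (\<Union>n. E n) \<le> \<delta>" using \<delta> by (simp add: emeasure_eq_measure)
  moreover have U: "(\<Union>n. E n) \<in> sets M" using E_sets by auto
  ultimately have "prob (space M - (\<Union>n. E n)) \<ge> 1 - \<delta>" by (simp add: prob_compl)
  moreover have "space M - (\<Union>n. E n) \<subseteq> ?G"
  proof
    fix \<omega> assume \<omega>: "\<omega> \<in> space M - (\<Union>n. E n)"
    then have le: "V n \<omega> \<le> c" for n by (auto simp: E_def not_less[symmetric])
    \<comment> \<open>Outside the union the stopping rule never acts, so \<open>V\<close> is the
      full product.\<close>
    have "V n \<omega> = (\<Prod>t = 1..n. h t (\<sigma> t \<omega>, \<xi> t \<omega>))" for n
    proof (induction n)
      case (Suc n)
      have "V (Suc n) \<omega> = V n \<omega> * h (Suc n) (\<sigma> (Suc n) \<omega>, \<xi> (Suc n) \<omega>)"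
        using le[of n] by (simp add: V_Suc not_less[symmetric])
      then show ?case by (simp add: Suc.IH mult.commute)
    qed (simp add: V_0)
    with le \<omega> show "\<omega> \<in> ?G" unfolding c_def by auto
  qed
  moreover have "?G \<in> sets M"
  proof -
    have "(\<lambda>\<omega>. \<Prod>t = 1..n. h t (\<sigma> t \<omega>, \<xi> t \<omega>)) \<in> borel_measurable M" for n
      by (intro borel_measurable_prod_ennreal measurable_compose[OF measurable_Pair h] \<sigma>_meas \<xi>_meas) auto
    then show ?thesis by measurable
  qed
  ultimately show ?thesis by (meson finite_measure_mono order_trans)
qed

end

section \<open>The regret bound\<close>

lemma borel_measurable_matrix_vector_mult [measurable (raw)]:
  fixes f :: "'a \<Rightarrow> real^'n^'m"
  assumes "f \<in> borel_measurable M" "g \<in> borel_measurable M"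
  shows "(\<lambda>x. f x *v g x) \<in> borel_measurable M"
  using assms
proof (rule borel_measurable_continuous_Pair)
  show "continuous_on UNIV (\<lambda>x::(real^'n^'m) \<times> (real^'n). fst x *v snd x)"
    unfolding matrix_vector_mult_def by (intro continuous_intros)
qed

lemma borel_measurable_matrix_matrix_mult [measurable (raw)]:
  fixes f :: "'a \<Rightarrow> real^'n^'m" and g :: "'a \<Rightarrow> real^'k^'n"
  assumes "f \<in> borel_measurable M" "g \<in> borel_measurable M"
  shows "(\<lambda>x. f x ** g x) \<in> borel_measurable M"
  using assms
proof (rule borel_measurable_continuous_Pair)
  show "continuous_on UNIV (\<lambda>x::(real^'n^'m) \<times> (real^'k^'n). fst x ** snd x)"
    unfolding matrix_matrix_mult_def by (intro continuous_intros)
qed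

lemma borel_measurable_outer [measurable (raw)]:
  fixes f :: "'a \<Rightarrow> real^'n"
  assumes "f \<in> borel_measurable M" "g \<in> borel_measurable M"
  shows "(\<lambda>x. outer (f x) (g x)) \<in> borel_measurable M"
  using assms
proof (rule borel_measurable_continuous_Pair)
  show "continuous_on UNIV (\<lambda>x::(real^'n) \<times> (real^'n). outer (fst x) (snd x))"
    unfolding outer_def by (intro continuous_intros)
qed

lemma borel_measurable_logistic_weight [measurable (raw)]:
  fixes f :: "'a \<Rightarrow> real^'n"
  assumes [measurable]: "f \<in> borel_measurable M" "g \<in> borel_measurable M"
  shows "(\<lambda>x. logistic_weight (f x) (g x)) \<in> borel_measurable M"
  unfolding logistic_weight_def by measurable

theorem theorem10:
  fixes M :: "'w measure"
    and S :: "(real ^ 'n) set"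
    and X :: "'w \<Rightarrow> real ^ 'n" and y :: "'w \<Rightarrow> real"
    and Xs :: "nat \<Rightarrow> 'w \<Rightarrow> real ^ 'n" and ys :: "nat \<Rightarrow> 'w \<Rightarrow> real"
    and \<alpha> :: "nat \<Rightarrow> 'w \<Rightarrow> real"
    and P :: "nat \<Rightarrow> 'w \<Rightarrow> real ^ 'n ^ 'n"
    and \<theta> :: "nat \<Rightarrow> 'w \<Rightarrow> real ^ 'n"
    and P1 :: "real ^ 'n ^ 'n" and \<theta>1 \<theta>star :: "real ^ 'n"
    and \<beta> D :: real
    and \<tau> :: "real \<Rightarrow> real \<Rightarrow> nat"
  defines "L \<equiv> logistic_risk M X y"
  assumes "prob_space M"
    and "0 < \<beta>" and "\<beta> < 1/2"
    and "pos_def P1"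
    and ekf: "\<And>\<omega>. \<omega> \<in> space M \<Longrightarrow>
          truncated_ekf \<beta> P1 \<theta>1 (\<lambda>t. Xs t \<omega>) (\<lambda>t. ys t \<omega>) (\<lambda>t. \<alpha> t \<omega>) (\<lambda>t. P t \<omega>) (\<lambda>t. \<theta> t \<omega>)"
    and rv: "(\<lambda>\<omega>. (X \<omega>, y \<omega>)) \<in> borel_measurable M"
    and range: "\<And>\<omega>. \<omega> \<in> space M \<Longrightarrow> X \<omega> \<in> S \<and> y \<omega> \<in> {-1, 1}"
    and ranges: "\<And>t \<omega>. t \<ge> 1 \<Longrightarrow> \<omega> \<in> space M \<Longrightarrow> Xs t \<omega> \<in> S \<and> ys t \<omega> \<in> {-1, 1}"
    and indep: "prob_space.indep_vars M (\<lambda>_. borel) (\<lambda>t \<omega>. (Xs t \<omega>, ys t \<omega>)) {1..}"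
    and ident: "\<And>t. t \<ge> 1 \<Longrightarrow>
          distr M borel (\<lambda>\<omega>. (Xs t \<omega>, ys t \<omega>)) = distr M borel (\<lambda>\<omega>. (X \<omega>, y \<omega>))"
    and "pos_def (LINT \<omega>|M. outer (X \<omega>) (X \<omega>))"
    and "\<And>x. x \<in> S \<Longrightarrow> norm x \<le> D"
    and "L \<theta>star = (INF \<theta>'. L \<theta>')"
    and conv: "\<And>\<delta> \<epsilon>. \<delta> > 0 \<Longrightarrow> \<epsilon> > 0 \<Longrightarrow>
          measure M {\<omega> \<in> space M. \<forall>t > \<tau> \<epsilon> \<delta>.
              norm (\<theta> t \<omega> - \<theta>star) \<le> \<epsilon> \<and> \<alpha> t \<omega> = logistic_weight (\<theta> t \<omega>) (Xs t \<omega>)} \<ge> 1 - \<delta>"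
  shows "\<forall>\<delta> > 0.
    measure M {\<omega> \<in> space M. \<forall>n\<ge>1.
      (\<Sum>t = 1..n. L (\<theta> t \<omega>) - L \<theta>star)
        \<le> 3 * real CARD('n) * exp (D * norm \<theta>star)
              * ln (1 + real n * (lambda_max P1 * D\<^sup>2 / (4 * real CARD('n))))
          + lambda_max (matrix_inv P1) / (75 * D\<^sup>2)
          + 64 * exp (D * norm \<theta>star) * ln (inverse \<delta>)
          + real (\<tau> (1 / (20 * D)) \<delta>) * (1 / 300 + D * norm (\<theta>1 - \<theta>star))
          + (real (\<tau> (1 / (20 * D)) \<delta>))\<^sup>2 * (lambda_max P1 * D\<^sup>2 / 2)} \<ge> 1 - 4 * \<delta>"
proof (intro allI impI)
  fix \<delta> :: real assume \<delta>: "\<delta> > 0"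
  interpret prob_space M by fact
  have X_le: "norm (X \<omega>) \<le> D" if "\<omega> \<in> space M" for \<omega> using range[OF that] assms(13) by blast
  \<comment> \<open>Without a positive bound \<open>X\<close> would vanish everywhere. Its
    second-moment matrix would then be zero, with trace 0, contradicting positive
    definiteness.\<close>
  have D: "D > 0"
  proof (rule ccontr)
    assume "\<not> D > 0"
    then have "X \<omega> = 0" if "\<omega> \<in> space M" for \<omega>
      using X_le[OF that] norm_ge_zero[of "X \<omega>"] by (metis norm_le_zero_iff not_less order_trans)
    then have "(LINT \<omega>|M. outer (X \<omega>) (X \<omega>)) = (LINT \<omega>|M. 0)"
      by (intro Bochner_Integration.integral_cong) (auto simp: outer_def vec_eq_iff)
    with \<open>pos_def (LINT \<omega>|M. outer (X \<omega>) (X \<omega>))\<close> have "pos_def (0 :: real^'n^'n)" by simp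
    then show False using lambda_max_pos[of "0 :: real^'n^'n"] pos_def_ln_det_le(2)[of "0 :: real^'n^'n"]
      by (simp add: trace_def)
  qed
  have rv': "(\<lambda>\<omega>. (X \<omega>, y \<omega>)) \<in> M \<rightarrow>\<^sub>M borel \<Otimes>\<^sub>M borel" using rv by (simp add: borel_prod)
  \<comment> \<open>A real infimum is known to be a lower bound only for sets bounded below; here 0
    is one because the loss is nonnegative.\<close>
  have bdd: "bdd_below (range L)"
    unfolding L_def logistic_risk_def
    by (intro bdd_belowI2[of _ 0] integral_nonneg) (simp add: logistic_loss_nonneg)
  interpret logistic_model M X y D \<theta>star
  proof unfold_locales
    show "X \<in> borel_measurable M" "y \<in> borel_measurable M"
      using measurable_compose[OF rv' measurable_fst] measurable_compose[OF rv' measurable_snd] by simp_all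
    show "logistic_risk M X y \<theta>star \<le> logistic_risk M X y \<theta>" for \<theta>
      using \<open>L \<theta>star = (INF \<theta>'. L \<theta>')\<close> cINF_lower[OF bdd, of \<theta>] by (simp add: L_def)
  qed (use X_le range D in auto)
  have path: "ekf_path \<beta> D P1 \<theta>1 (\<lambda>t. Xs t \<omega>) (\<lambda>t. ys t \<omega>) (\<lambda>t. \<alpha> t \<omega>) (\<lambda>t. P t \<omega>) (\<lambda>t. \<theta> t \<omega>)"
    if "\<omega> \<in> space M" for \<omega>
    using ekf[OF that] ranges[OF _ that] assms by unfold_locales auto

  define T where "T = \<tau> (1 / (20 * D)) \<delta>"
  define \<xi> where "\<xi> t \<omega> = (Xs t \<omega>, ys t \<omega>)" for t \<omega>
  define \<sigma> where "\<sigma> t \<omega> = (\<theta> t \<omega>, P t \<omega>)" for t \<omega>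
  \<comment> \<open>\<alpha> is determined by the time, the current state and the observation, so
    the pair of \<theta> and \<open>P\<close> is a complete state. The update of \<theta> uses the
    new matrix, which is why \<open>P'\<close> is defined separately.\<close>
  define P' :: "nat \<Rightarrow> ((real^'n) \<times> (real^'n^'n)) \<times> (real^'n) \<times> real \<Rightarrow> real^'n^'n" where
    "P' t p = (let \<theta> = fst (fst p); P = snd (fst p); x = fst (snd p);
         a = max (1 / real t powr \<beta>) (logistic_weight \<theta> x)
       in P - (a / (1 + (x \<bullet> (P *v x)) * a)) *\<^sub>R (P ** outer x x ** P))" for t p
  define F where "F t p = (let \<theta> = fst (fst p); x = fst (snd p); y = snd (snd p)
      in (\<theta> + P' t p *v ((y / (1 + exp (y * (\<theta> \<bullet> x)))) *\<^sub>R x), P' t p))" for t p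
  define Z where "Z p = (case p of ((\<theta>, P :: real^'n^'n), (x, y)) \<Rightarrow> (1 / (64 * exp (D * norm \<theta>star))) * (L \<theta> - L \<theta>star
      - (2 * (logistic_deriv y (\<theta> \<bullet> x) * ((\<theta> - \<theta>star) \<bullet> x))
         - logistic_weight \<theta> x * ((\<theta> - \<theta>star) \<bullet> x)\<^sup>2)))" for p
  \<comment> \<open>The guard makes the bound on the mean hold in every state: inside the ball it is
    \<open>exp_moment_le_1\<close>, elsewhere the factor is 1. Only \<theta> and the time enter the
    guard, not the equality for \<alpha>.\<close>
  define h where "h t p = (if t > T \<and> norm (fst (fst p) - \<theta>star) \<le> 1 / (20 * D) then ennreal (exp (Z p)) else 1)"
    for t :: nat and p
  have P'_meas [measurable]: "P' t \<in> borel_measurable ((borel \<Otimes>\<^sub>M borel) \<Otimes>\<^sub>M (borel \<Otimes>\<^sub>M borel))" for t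
    unfolding P'_def[abs_def] Let_def by measurable
  have F_meas: "F t \<in> (borel \<Otimes>\<^sub>M borel) \<Otimes>\<^sub>M (borel \<Otimes>\<^sub>M borel) \<rightarrow>\<^sub>M borel \<Otimes>\<^sub>M borel" for t
    unfolding F_def[abs_def] Let_def by measurable
  have L_meas [measurable]: "L \<in> borel_measurable borel" unfolding L_def by (rule borel_measurable_risk)
  have Z_meas [measurable]: "Z \<in> borel_measurable ((borel \<Otimes>\<^sub>M borel) \<Otimes>\<^sub>M (borel \<Otimes>\<^sub>M borel))"
    unfolding Z_def[abs_def] logistic_deriv_def split_beta by measurable
  have h_meas: "h t \<in> borel_measurable ((borel \<Otimes>\<^sub>M borel) \<Otimes>\<^sub>M (borel \<Otimes>\<^sub>M borel))" for t
    unfolding h_def[abs_def] by measurable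
  have indep': "indep_vars (\<lambda>_. borel \<Otimes>\<^sub>M borel) \<xi> {1..}"
    using indep by (simp add: \<xi>_def[abs_def] borel_prod)
  have \<sigma>_1: "\<sigma> 1 \<omega> = (\<theta>1, P1)" if "\<omega> \<in> space M" for \<omega>
    using ekf[OF that] by (simp add: \<sigma>_def truncated_ekf_def)
  have \<sigma>_Suc: "\<sigma> (Suc t) \<omega> = F t (\<sigma> t \<omega>, \<xi> t \<omega>)" if "t \<ge> 1" "\<omega> \<in> space M" for t \<omega>
    using ekf[OF that(2)] that(1) by (simp add: \<sigma>_def \<xi>_def F_def P'_def truncated_ekf_def Let_def)
  have h_le: "(\<integral>\<^sup>+x. h t (s, x) \<partial>distr M (borel \<Otimes>\<^sub>M borel) (\<xi> t)) \<le> 1" if "t \<ge> 1" for t s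
  proof -
    have "distr M (borel \<Otimes>\<^sub>M borel) (\<xi> t) = distr M (borel \<Otimes>\<^sub>M borel) (\<lambda>\<omega>. (X \<omega>, y \<omega>))"
      using ident[OF that] by (simp add: \<xi>_def[abs_def] borel_prod)
    then have "(\<integral>\<^sup>+x. h t (s, x) \<partial>distr M (borel \<Otimes>\<^sub>M borel) (\<xi> t)) = (\<integral>\<^sup>+\<omega>. h t (s, (X \<omega>, y \<omega>)) \<partial>M)"
      using nn_integral_distr[OF rv', of "\<lambda>x. h t (s, x)"] measurable_compose_Pair1[OF _ h_meas, of s t]
      by (simp add: space_pair_measure)
    also have "\<dots> \<le> 1"
    proof (cases "t > T \<and> norm (fst s - \<theta>star) \<le> 1 / (20 * D)")
      case True
      then show ?thesis using exp_moment_le_1[of "fst s"]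
        by (simp add: h_def Z_def L_def split_beta)
    next
      case False
      then have "h t (s, (X \<omega>, y \<omega>)) = 1" for \<omega> unfolding h_def by (simp only: fst_conv) simp
      then show ?thesis by (simp add: emeasure_space_1)
    qed
    finally show ?thesis .
  qed
  have space0: "(\<theta>1, P1) \<in> space (borel \<Otimes>\<^sub>M borel)" by (simp add: space_pair_measure)
  have \<theta>_meas: "\<theta> t \<in> borel_measurable M" if "t \<ge> 1" for t
  proof -
    have "\<sigma> t \<in> M \<rightarrow>\<^sub>M borel \<Otimes>\<^sub>M borel"
      by (rule nn_integral_state_input(1)[OF indep' F_meas space0 \<sigma>_1 \<sigma>_Suc, of "\<lambda>_. 0"]) (use that in auto)
    from measurable_compose[OF this measurable_fst] show ?thesis by (simp add: \<sigma>_def)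
  qed
  define A where "A = {\<omega> \<in> space M. \<forall>t > T. norm (\<theta> t \<omega> - \<theta>star) \<le> 1 / (20 * D)
      \<and> \<alpha> t \<omega> = logistic_weight (\<theta> t \<omega>) (Xs t \<omega>)}"
  define B where "B = {\<omega> \<in> space M. \<forall>n. (\<Prod>t = 1..n. h t (\<sigma> t \<omega>, \<xi> t \<omega>)) \<le> ennreal (1 / \<delta>)}"
  define bound where "bound n = 3 * real CARD('n) * exp (D * norm \<theta>star)
              * ln (1 + real n * (lambda_max P1 * D\<^sup>2 / (4 * real CARD('n))))
          + lambda_max (matrix_inv P1) / (75 * D\<^sup>2)
          + 64 * exp (D * norm \<theta>star) * ln (inverse \<delta>)
          + real T * (1 / 300 + D * norm (\<theta>1 - \<theta>star))
          + (real T)\<^sup>2 * (lambda_max P1 * D\<^sup>2 / 2)" for n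
  let ?G = "{\<omega> \<in> space M. \<forall>n\<ge>1. (\<Sum>t = 1..n. L (\<theta> t \<omega>) - L \<theta>star) \<le> bound n}"
  have A: "prob A \<ge> 1 - \<delta>" using conv[OF \<delta>, of "1 / (20 * D)"] D by (simp add: A_def T_def)
  have B: "prob B \<ge> 1 - \<delta>" unfolding B_def
    by (rule ville_state_machine[OF indep' F_meas space0 \<sigma>_1 \<sigma>_Suc h_meas h_le \<delta>])
  have "prob ?G \<ge> 1 - 4 * \<delta>"
  proof (cases "\<delta> < 1 / 4")
    case False
    then have "1 - 4 * \<delta> \<le> 0" by simp
    then show ?thesis using measure_nonneg[of M ?G] by linarith
  next
    case True
    \<comment> \<open>The measure of a non-measurable set is 0, so the lower bound
      \<open>1 - \<delta>\<close>, positive in this case, already yields measurability.\<close>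
    have sets: "A \<in> sets M" "B \<in> sets M"
      using A B True measure_notin_sets[of A M] measure_notin_sets[of B M] by force+
    have [measurable]: "(\<lambda>\<omega>. \<Sum>t = 1..n. L (\<theta> t \<omega>) - L \<theta>star) \<in> borel_measurable M" for n
      by (intro borel_measurable_sum borel_measurable_diff borel_measurable_const
          measurable_compose[OF \<theta>_meas L_meas]) auto
    have G: "?G \<in> sets M" by measurable
    have sub: "A \<inter> B \<subseteq> ?G"
    proof safe
      fix \<omega> n assume \<omega>A: "\<omega> \<in> A" and \<omega>B: "\<omega> \<in> B"
      have \<omega>: "\<omega> \<in> space M" using \<omega>A by (simp add: A_def)
      then show "\<omega> \<in> space M" .
      interpret path: ekf_path \<beta> D P1 \<theta>1 "\<lambda>t. Xs t \<omega>" "\<lambda>t. ys t \<omega>" "\<lambda>t. \<alpha> t \<omega>" "\<lambda>t. P t \<omega>" "\<lambda>t. \<theta> t \<omega>"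
        by (rule path[OF \<omega>])
      have near: "norm (\<theta> t \<omega> - \<theta>star) \<le> 1 / (20 * D) \<and> \<alpha> t \<omega> = logistic_weight (\<theta> t \<omega>) (Xs t \<omega>)" if "t > T" for t
        using \<omega>A that by (auto simp: A_def)
      have "(\<Sum>t = Suc T..n. Z (\<sigma> t \<omega>, \<xi> t \<omega>)) \<le> ln (1 / \<delta>)" if "T \<le> n"
      proof -
        have split: "{1..n} = {1..T} \<union> {Suc T..n}" "{1..T} \<inter> {Suc T..n} = {}" using that by auto
        have le: "(\<Prod>t = 1..n. h t (\<sigma> t \<omega>, \<xi> t \<omega>)) \<le> ennreal (1 / \<delta>)"
          using \<omega>B by (auto simp: B_def)
        have "(\<Prod>t = 1..n. h t (\<sigma> t \<omega>, \<xi> t \<omega>)) = (\<Prod>t = 1..T. h t (\<sigma> t \<omega>, \<xi> t \<omega>)) * (\<Prod>t = Suc T..n. h t (\<sigma> t \<omega>, \<xi> t \<omega>))"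
          unfolding split(1) by (rule prod.union_disjoint) (use split in auto)
        \<comment> \<open>Up to \<open>T\<close> the guard is off and all factors are 1; after
          \<open>T\<close>, membership in \<open>A\<close> switches it on at every time.\<close>
        also have "(\<Prod>t = 1..T. h t (\<sigma> t \<omega>, \<xi> t \<omega>)) = 1" by (intro prod.neutral) (simp add: h_def)
        also have "(\<Prod>t = Suc T..n. h t (\<sigma> t \<omega>, \<xi> t \<omega>)) = (\<Prod>t = Suc T..n. ennreal (exp (Z (\<sigma> t \<omega>, \<xi> t \<omega>))))"
          using near by (intro prod.cong) (auto simp: h_def \<sigma>_def)
        also have "\<dots> = ennreal (exp (\<Sum>t = Suc T..n. Z (\<sigma> t \<omega>, \<xi> t \<omega>)))"
          by (simp add: prod_ennreal exp_sum)
        finally have "ennreal (exp (\<Sum>t = Suc T..n. Z (\<sigma> t \<omega>, \<xi> t \<omega>))) \<le> ennreal (1 / \<delta>)"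
          using le by (simp only: mult_1)
        then have "exp (\<Sum>t = Suc T..n. Z (\<sigma> t \<omega>, \<xi> t \<omega>)) \<le> 1 / \<delta>" using \<delta> by simp
        then show ?thesis using \<delta> by (simp add: ln_ge_iff)
      qed
      then show "(\<Sum>t = 1..n. L (\<theta> t \<omega>) - L \<theta>star) \<le> bound n"
        unfolding bound_def
        using \<delta> True near risk_lipschitz[of _ \<theta>star]
        by (intro path.regret_le D) (auto simp: Z_def \<sigma>_def \<xi>_def L_def abs_le_iff)
    qed
    \<comment> \<open>Only two events can fail, convergence and Ville's bound. Their union costs
      \<open>2 * \<delta>\<close>, within the allowed \<open>4 * \<delta>\<close>.\<close>
    have "prob (space M - A) \<le> \<delta>" "prob (space M - B) \<le> \<delta>"
      using A B sets by (simp_all add: prob_compl)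
    then have "prob ((space M - A) \<union> (space M - B)) \<le> 2 * \<delta>"
      using measure_Un_le[of "space M - A" M "space M - B"] sets by simp
    moreover have "space M - A \<inter> B = (space M - A) \<union> (space M - B)" by auto
    moreover have "prob (space M - A \<inter> B) = 1 - prob (A \<inter> B)" using sets by (intro prob_compl) auto
    ultimately have "prob (A \<inter> B) \<ge> 1 - 2 * \<delta>" by simp
    also have "prob (A \<inter> B) \<le> prob ?G" using sub G by (rule finite_measure_mono)
    finally show ?thesis using \<delta> by linarith
  qed
  then show "measure M {\<omega> \<in> space M. \<forall>n\<ge>1.
      (\<Sum>t = 1..n. L (\<theta> t \<omega>) - L \<theta>star)
        \<le> 3 * real CARD('n) * exp (D * norm \<theta>star)
              * ln (1 + real n * (lambda_max P1 * D\<^sup>2 / (4 * real CARD('n))))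
          + lambda_max (matrix_inv P1) / (75 * D\<^sup>2)
          + 64 * exp (D * norm \<theta>star) * ln (inverse \<delta>)
          + real (\<tau> (1 / (20 * D)) \<delta>) * (1 / 300 + D * norm (\<theta>1 - \<theta>star))
          + (real (\<tau> (1 / (20 * D)) \<delta>))\<^sup>2 * (lambda_max P1 * D\<^sup>2 / 2)} \<ge> 1 - 4 * \<delta>"
    unfolding bound_def T_def .
qed

end
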